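(* Let $\mathcal{H}$ be a complex Hilbert space, let $S$ be a positive, densely defined, closed operator in $\mathcal{H}$, and let $F$ be the Friedrichs extension of $S$. Let $T=(I-S)(I+S)^{-1}\colon\operatorname{Ran}(I+S)\to\mathcal{H}$ be the Cayley transform of $S$, let $\widetilde T(-I)$ be as defined in the context, and let $$\widetilde S_{\mathrm F}=\widetilde S(-I)=(I-\widetilde T(-I))(I+\widetilde T(-I))^{-1},\qquad \operatorname{Dom}(\widetilde S_{\mathrm F})=\operatorname{Ran}(I+\widetilde T(-I)).$$ Then $\widetilde S_{\mathrm F}=F$.
   Context: Operators are linear and possibly unbounded. A densely defined operator $S$ in $\mathcal{H}$ is positive if it is symmetric and $\langle Sh,h\rangle\geq 0$ for all $h\in\operatorname{Dom}(S)$. For $S$ positive, closed and densely defined, $I+S$ is one-to-one, $\operatorname{Ran}(I+S)$ is closed, and the Cayley transform $T=(I-S)(I+S)^{-1}$, with $\operatorname{Dom}(T)=\operatorname{Ran}(I+S)$, is a symmetric contraction: $\|Tx\|\le\|x\|$ and $\langle Tx,y\rangle=\langle x,Ty\rangle$ for all $x,y\in\operatorname{Dom}(T)$. For a contraction $C\colon\mathcal{H}_1\to\mathcal{H}_2$ between Hilbert spaces, $D_C=(I-C^*C)^{1/2}$ and $\mathcal{D}_C=\overline{D_C\mathcal{H}_1}$. With respect to $\mathcal{H}=\operatorname{Dom}(T)\oplus(\mathcal{H}\ominus\operatorname{Dom}(T))$ one writes uniquely $T=\begin{bmatrix}A\\ \Gamma_2D_A\end{bmatrix}$, where $A\colon\operatorname{Dom}(T)\to\operatorname{Dom}(T)$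 is a selfadjoint contraction and $\Gamma_2\colon\mathcal{D}_A\to\mathcal{H}\ominus\operatorname{Dom}(T)$ is a contraction. Then $$\widetilde T(-I)=\begin{bmatrix}A & D_A\Gamma_2^*\\ \Gamma_2D_A & -\Gamma_2A\Gamma_2^*-D_{\Gamma_2^*}^2\end{bmatrix}=\begin{bmatrix}A & D_A\Gamma_2^*\\ \Gamma_2D_A & \Gamma_2(I-A)\Gamma_2^*-I\end{bmatrix},$$ a selfadjoint contraction on $\mathcal{H}$ extending $T$; $I+\widetilde T(-I)$ is one-to-one and $\widetilde S(-I)$ is a positive selfadjoint extension of $S$. The Friedrichs extension $F$ of $S$ is the selfadjoint operator given by $$\operatorname{Dom}(F)=\{\xi\in\operatorname{Dom}(S^* )\mid \exists\,(\xi_n)_{n\in\mathbb{N}}\text{ in }\operatorname{Dom}(S),\ \xi_n\to\xi\text{ in norm and }\langle \xi_n-\xi_m,S(\xi_n-\xi_m)\rangle\to0\text{ as }m,n\to\infty\},$$ and $F\xi=S^*\xi$ for $\xi\in\operatorname{Dom}(F)$. *)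

theory Defs
  imports "HOL-Analysis.Analysis"
begin

section \<open>Complex Hilbert spaces\<close>

text \<open>The inner product is linear in its first argument.\<close>

class complex_inner = real_normed_vector +
  fixes scaleC :: "complex \<Rightarrow> 'a \<Rightarrow> 'a" (infixr \<open>*\<^sub>C\<close> 75)
    and cinner :: "'a \<Rightarrow> 'a \<Rightarrow> complex"
  assumes scaleC_add_right: "a *\<^sub>C (x + y) = a *\<^sub>C x + a *\<^sub>C y"
    and scaleC_add_left: "(a + b) *\<^sub>C x = a *\<^sub>C x + b *\<^sub>C x"
    and scaleC_scaleC: "a *\<^sub>C b *\<^sub>C x = (a * b) *\<^sub>C x"
    and scaleC_one: "1 *\<^sub>C x = x"
    and scaleR_scaleC: "r *\<^sub>R x = complex_of_real r *\<^sub>C x"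
    and cinner_commute: "cinner x y = cnj (cinner y x)"
    and cinner_add_left: "cinner (x + y) z = cinner x z + cinner y z"
    and cinner_scaleC_left: "cinner (a *\<^sub>C x) y = a * cinner x y"
    and cinner_self_nonneg: "cinner x x \<in> \<real>\<^sub>\<ge>\<^sub>0"
    and cinner_self_eq_zero_iff: "cinner x x = 0 \<longleftrightarrow> x = 0"
    and norm_eq_sqrt_cinner: "norm x = sqrt (Re (cinner x x))"

class chilbert_space = complex_inner + complete_space

instantiation complex :: chilbert_space
begin

definition scaleC_complex :: "complex \<Rightarrow> complex \<Rightarrow> complex"
  where "scaleC_complex a x = a * x"

definition cinner_complex :: "complex \<Rightarrow> complex \<Rightarrow> complex"
  where "cinner_complex x y = x * cnj y"

instance
  by standard
    (auto simp: scaleC_complex_def cinner_complex_def algebra_simps scaleR_conv_of_real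
      complex_mult_cnj complex_nonneg_Reals_iff cmod_def complex_eq_iff power2_eq_square
      sum_squares_eq_zero_iff)

end

definition ortho :: "'a::complex_inner set \<Rightarrow> 'a set"
  where "ortho M = {y. \<forall>x\<in>M. cinner x y = 0}"


section \<open>Operators as graphs\<close>

text \<open>
  A possibly unbounded operator is identified with its graph, a single-valued linear relation, so
  equality of operators includes equality of domains.  The domain and range of X are \<open>Domain X\<close>
  and \<open>Range X\<close>, the inverse of an injective X is \<open>X\<inverse>\<close>, the identity of a subspace M is
  \<open>Id_on M\<close> (with \<open>Id\<close> that of the whole space), and the product XY (first Y, then X) is \<open>Y O X\<close>.
  Sums and products have their natural domains.
\<close>

definition linear_op :: "'a::complex_inner rel \<Rightarrow> bool"
  where "linear_op X \<longleftrightarrow> single_valued X \<and> (0, 0) \<in> X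
    \<and> (\<forall>(x, y)\<in>X. \<forall>(x', y')\<in>X. (x + x', y + y') \<in> X)
    \<and> (\<forall>c. \<forall>(x, y)\<in>X. (c *\<^sub>C x, c *\<^sub>C y) \<in> X)"

definition op_app :: "'a rel \<Rightarrow> 'a \<Rightarrow> 'a" (infixr \<open>\<diamondop>\<close> 90)
  where "X \<diamondop> x = (THE y. (x, y) \<in> X)"

definition op_plus :: "'a::complex_inner rel \<Rightarrow> 'a rel \<Rightarrow> 'a rel" (infixl \<open>\<oplus>\<^sub>o\<close> 65)
  where "X \<oplus>\<^sub>o Y = {(x, y + z) | x y z. (x, y) \<in> X \<and> (x, z) \<in> Y}"

definition op_minus :: "'a::complex_inner rel \<Rightarrow> 'a rel \<Rightarrow> 'a rel" (infixl \<open>\<ominus>\<^sub>o\<close> 65)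
  where "X \<ominus>\<^sub>o Y = {(x, y - z) | x y z. (x, y) \<in> X \<and> (x, z) \<in> Y}"

definition op_uminus :: "'a::complex_inner rel \<Rightarrow> 'a rel"
  where "op_uminus X = {(x, - y) | x y. (x, y) \<in> X}"

text \<open>
  In the following M and N are closed subspaces, regarded as Hilbert spaces in their own right;
  \<open>op_adjoint M N X\<close> is the adjoint of an operator X from M to N with domain dense in M.
\<close>

definition op_adjoint :: "'a::complex_inner set \<Rightarrow> 'a set \<Rightarrow> 'a rel \<Rightarrow> 'a rel"
  where "op_adjoint M N X =
    {(y, z). y \<in> N \<and> z \<in> M \<and> (\<forall>(x, w)\<in>X. cinner w y = cinner x z)}"

definition selfadjoint_op :: "'a::complex_inner set \<Rightarrow> 'a rel \<Rightarrow> bool"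
  where "selfadjoint_op M X \<longleftrightarrow> op_adjoint M M X = X"

definition symmetric_op :: "'a::complex_inner rel \<Rightarrow> bool"
  where "symmetric_op X \<longleftrightarrow> (\<forall>(x, y)\<in>X. \<forall>(x', y')\<in>X. cinner y x' = cinner x y')"

definition densely_defined :: "'a::complex_inner set \<Rightarrow> 'a rel \<Rightarrow> bool"
  where "densely_defined M X \<longleftrightarrow> Domain X \<subseteq> M \<and> M \<subseteq> closure (Domain X)"

definition positive_op :: "'a::complex_inner set \<Rightarrow> 'a rel \<Rightarrow> bool"
  where "positive_op M X \<longleftrightarrow> linear_op X \<and> densely_defined M X \<and> Range X \<subseteq> M
    \<and> symmetric_op X \<and> (\<forall>(x, y)\<in>X. cinner y x \<in> \<real>\<^sub>\<ge>\<^sub>0)"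

definition bounded_op :: "'a::complex_inner set \<Rightarrow> 'a set \<Rightarrow> 'a rel \<Rightarrow> bool"
  where "bounded_op M N X \<longleftrightarrow> linear_op X \<and> Domain X = M \<and> Range X \<subseteq> N
    \<and> (\<exists>K. \<forall>(x, y)\<in>X. norm y \<le> K * norm x)"

definition contraction :: "'a::complex_inner set \<Rightarrow> 'a set \<Rightarrow> 'a rel \<Rightarrow> bool"
  where "contraction M N X \<longleftrightarrow> linear_op X \<and> Domain X = M \<and> Range X \<subseteq> N
    \<and> (\<forall>(x, y)\<in>X. norm y \<le> norm x)"

definition pos_sqrt :: "'a::complex_inner set \<Rightarrow> 'a rel \<Rightarrow> 'a rel"
  where "pos_sqrt M B = (THE R. bounded_op M M R \<and> positive_op M R \<and> R O R = B)"

definition defect_op :: "'a::complex_inner set \<Rightarrow> 'a set \<Rightarrow> 'a rel \<Rightarrow> 'a rel"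
  where "defect_op M N C = pos_sqrt M (Id_on M \<ominus>\<^sub>o (C O op_adjoint M N C))"

definition defect_space :: "'a::complex_inner set \<Rightarrow> 'a set \<Rightarrow> 'a rel \<Rightarrow> 'a set"
  where "defect_space M N C = closure (defect_op M N C `` M)"


section \<open>Cayley transform and the extension with parameter -I\<close>

definition cayley :: "'a::complex_inner rel \<Rightarrow> 'a rel"
  where "cayley X = (Id \<oplus>\<^sub>o X)\<inverse> O (Id \<ominus>\<^sub>o X)"

text \<open>
  With M the domain of T, the column with entries \<open>X: M \<rightarrow> M\<close> and \<open>Y: M \<rightarrow> ortho M\<close> is \<open>X \<oplus>\<^sub>o Y\<close>,
  since M and its orthogonal complement are both subspaces of the ambient space.
\<close>

definition column_form :: "'a::complex_inner rel \<Rightarrow> 'a rel \<Rightarrow> 'a rel \<Rightarrow> bool"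
  where "column_form T A G \<longleftrightarrow> (let M = Domain T in
      contraction M M A \<and> selfadjoint_op M A
    \<and> contraction (defect_space M M A) (ortho M) G
    \<and> T = A \<oplus>\<^sub>o (defect_op M M A O G))"

definition block_op :: "'a::complex_inner rel \<Rightarrow> 'a rel \<Rightarrow> 'a rel \<Rightarrow> 'a rel \<Rightarrow> 'a rel"
  where "block_op X11 X12 X21 X22 = {(u + v, (a + b) + (c + d)) | u v a b c d.
    (u, a) \<in> X11 \<and> (v, b) \<in> X12 \<and> (u, c) \<in> X21 \<and> (v, d) \<in> X22}"

definition T_tilde_neg_I :: "'a::complex_inner rel \<Rightarrow> 'a rel"
  where "T_tilde_neg_I T =
    (let M = Domain T;
         N = ortho M;
         (A, G) = (THE (A, G). column_form T A G);
         DA = defect_op M M A;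
         Gadj = op_adjoint (defect_space M M A) N G;
         DGadj = defect_op N (defect_space M M A) Gadj
     in block_op
          A         (Gadj O DA)
          (DA O G)  (op_uminus (Gadj O A O G) \<ominus>\<^sub>o (DGadj O DGadj)))"

definition S_tilde_F :: "'a::complex_inner rel \<Rightarrow> 'a rel"
  where "S_tilde_F S = cayley (T_tilde_neg_I (cayley S))"


section \<open>The Friedrichs extension\<close>

definition friedrichs_ext :: "'a::complex_inner rel \<Rightarrow> 'a rel"
  where "friedrichs_ext S = {(\<xi>, \<eta>) \<in> op_adjoint UNIV UNIV S.
    \<exists>x :: nat \<Rightarrow> 'a. (\<forall>n. x n \<in> Domain S) \<and> x \<longlonglongrightarrow> \<xi> \<and>
      ((\<lambda>(m, n). cinner (x n - x m) (S \<diamondop> (x n - x m))) \<longlongrightarrow> 0)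
        (sequentially \<times>\<^sub>F sequentially)}"

end

theory Submission
  imports Defs
begin

text \<open>
  Put \<open>K = T\<^sup>~(-I)\<close>. Since K is selfadjoint, so is \<open>S\<^sub>F = (I - K) (I + K)\<inverse>\<close>, and F is symmetric;
  hence \<open>S\<^sub>F = F\<close> as soon as \<open>S\<^sub>F \<subseteq> F\<close>. A vector \<open>(I + K) x\<close> lies in the domain of F if x is
  approximated by vectors \<open>h\<^sub>n\<close> of \<open>M = Dom T\<close> with respect to the form of \<open>I + K\<close>, since then
  \<open>(I + K) h\<^sub>n = (I + T) h\<^sub>n\<close> is in the domain of S and is Cauchy for the form of S. The block
  entries of \<open>I + K\<close> are \<open>I + A\<close>, \<open>D \<Gamma>\<^sup>*\<close>, \<open>\<Gamma> D\<close> and \<open>\<Gamma> (I - A) \<Gamma>\<^sup>*\<close>, and as \<open>D\<^sup>2 = (I + A) (I - A)\<close>,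
  the matrix with entries \<open>I + A\<close>, D, D, \<open>I - A\<close> annihilates the pairs \<open>((I - A) \<kappa>, - D \<kappa>)\<close>. So for v
  orthogonal to M one takes \<open>h\<^sub>n = (I - A) \<kappa>\<^sub>n\<close> with \<open>D \<kappa>\<^sub>n \<longlonglongrightarrow> \<Gamma>\<^sup>* v\<close>.
\<close>

section \<open>Complex Hilbert spaces\<close>

text \<open>\<open>M\<close> is closed, so a vector x with a component orthogonal to
  \<open>M\<close> is never a norm limit of vectors \<open>h\<^sub>n\<close> of \<open>M\<close>.
  What can converge is \<open>(I + K) h\<^sub>n\<close>, and the \<open>\<kappa>\<^sub>n\<close>
  that produce it may diverge. The choice works because both \<open>(I + K) h\<^sub>n\<close> and
  the form of \<open>I + K\<close> at differences of the \<open>h\<^sub>n\<close> involve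
  \<open>\<kappa>\<^sub>n\<close> only through \<open>D \<kappa>\<^sub>n\<close>, on which bounded
  operators act; this rests on \<open>A D = D A\<close>. The passage from the form of
  \<open>I + K\<close> to that of S is the identity \<open><(I + K) e, (I - K) e> = 2 <e, (I + K) e>
  - |(I + K) e|\<^sup>2\<close>, whose last term is governed by norm convergence. Square roots and
  the pair \<open>(A, \<Gamma>)\<close> enter through definite descriptions, so nothing can be
  computed before existence and uniqueness of both are established. The square root is built as a
  limit of polynomials in the given operator: it then commutes with everything that operator
  commutes with, which yields its uniqueness as well as \<open>A D = D A\<close>.\<close>

instance chilbert_space \<subseteq> banach ..

lemma cinner_add_right: "cinner x (y + z) = cinner x y + cinner x (z :: 'a::complex_inner)"
  using cinner_add_left cinner_commute by (metis complex_cnj_add)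

lemma cinner_scaleC_right: "cinner x (a *\<^sub>C y) = cnj a * cinner x (y :: 'a::complex_inner)"
  using cinner_scaleC_left cinner_commute by (metis complex_cnj_mult)

lemma cinner_scaleR_left: "cinner (r *\<^sub>R x) y = of_real r * cinner x (y :: 'a::complex_inner)"
  by (simp add: scaleR_scaleC cinner_scaleC_left)

lemma cinner_scaleR_right: "cinner x (r *\<^sub>R y) = of_real r * cinner x (y :: 'a::complex_inner)"
  by (simp add: scaleR_scaleC cinner_scaleC_right)

lemma cinner_self: "cinner x x = of_real ((norm (x :: 'a::complex_inner))\<^sup>2)"
proof -
  have "Re (cinner x x) \<ge> 0" "Im (cinner x x) = 0"
    using cinner_self_nonneg[of x] by (auto simp: complex_nonneg_Reals_iff)
  then show ?thesis
    by (simp add: norm_eq_sqrt_cinner complex_eq_iff)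
qed

lemma power2_norm_eq_cinner: "(norm x)\<^sup>2 = Re (cinner x (x :: 'a::complex_inner))"
  by (simp add: cinner_self)

lemma scaleC_minus_one: "(-1) *\<^sub>C x = - (x :: 'a::complex_inner)"
  using scaleR_scaleC[of "-1" x] by simp

lemma linear_opD:
  assumes "linear_op X"
  shows "single_valued X" "(0, 0) \<in> X"
    "(x, y) \<in> X \<Longrightarrow> (x', y') \<in> X \<Longrightarrow> (x + x', y + y') \<in> X"
    "(x, y) \<in> X \<Longrightarrow> (c *\<^sub>C x, c *\<^sub>C y) \<in> X"
    "(x, y) \<in> X \<Longrightarrow> (x', y') \<in> X \<Longrightarrow> (x - x', y - y') \<in> X"
proof -
  show "single_valued X" and "(0, 0) \<in> X"
    and add: "(x, y) \<in> X \<Longrightarrow> (x', y') \<in> X \<Longrightarrow> (x + x', y + y') \<in> X"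
    and sc: "(x, y) \<in> X \<Longrightarrow> (c *\<^sub>C x, c *\<^sub>C y) \<in> X" for x y x' y' c
    using assms unfolding linear_op_def by fast+
  show "(x, y) \<in> X \<Longrightarrow> (x', y') \<in> X \<Longrightarrow> (x - x', y - y') \<in> X"
    using add[of x y "- x'" "- y'"] sc[of x' y' "-1"] by (simp add: scaleC_minus_one)
qed

lemma positive_opD:
  assumes "positive_op M X"
  shows "linear_op X" "densely_defined M X" "Range X \<subseteq> M"
    "(x, y) \<in> X \<Longrightarrow> (x', y') \<in> X \<Longrightarrow> cinner y x' = cinner x y'"
    "(x, y) \<in> X \<Longrightarrow> cinner y x \<in> \<real>\<^sub>\<ge>\<^sub>0"
    "(x, y) \<in> X \<Longrightarrow> Re (cinner y x) \<ge> 0"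
proof -
  show "linear_op X" "densely_defined M X" "Range X \<subseteq> M"
    "(x, y) \<in> X \<Longrightarrow> (x', y') \<in> X \<Longrightarrow> cinner y x' = cinner x y'"
    and "(x, y) \<in> X \<Longrightarrow> cinner y x \<in> \<real>\<^sub>\<ge>\<^sub>0"
    using assms unfolding positive_op_def symmetric_op_def by fast+
  then show "(x, y) \<in> X \<Longrightarrow> Re (cinner y x) \<ge> 0"
    by (auto simp: complex_nonneg_Reals_iff)
qed

text \<open>A discriminant argument: the form is nonnegative at \<open>x + c *\<^sub>C x'\<close>
  for every c. It may vanish at nonzero vectors, hence the separate case. \<open>X = Id\<close>
  gives the inequality for the inner product, \<open>X = S\<close> the symmetry of the Friedrichs
  extension, and a square root gives \<open>positive_op_kernel\<close>.\<close>

lemma positive_op_Cauchy_Schwarz: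
  assumes X: "positive_op M X" and xy: "(x, y) \<in> X" "(x', y') \<in> X"
  shows "(cmod (cinner y x'))\<^sup>2 \<le> Re (cinner y x) * Re (cinner y' x')"
proof -
  note D = positive_opD[OF X] and L = linear_opD[OF positive_opD(1)[OF X]]
  define s where "s = cinner y x'"
  have s': "cinner y' x = cnj s"
    using D(4)[OF xy(2) xy(1)] cinner_commute s_def by metis
  have ge: "Re (cinner y x) - 2 * t * (cmod s)\<^sup>2 + t\<^sup>2 * (cmod s)\<^sup>2 * Re (cinner y' x') \<ge> 0" for t
  proof -
    \<comment> \<open>The factor s fixes the phase of c, so that both cross terms equal the real
      number \<open>- t * (cmod s)\<^sup>2\<close>.\<close>
    define c where "c = - of_real t * s"
    have "(x + c *\<^sub>C x', y + c *\<^sub>C y') \<in> X"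
      using xy L by blast
    then have "0 \<le> Re (cinner (y + c *\<^sub>C y') (x + c *\<^sub>C x'))"
      using D(6) by blast
    also have "cinner (y + c *\<^sub>C y') (x + c *\<^sub>C x') =
      cinner y x + (cnj c * s + c * cnj s) + (c * cnj c) * cinner y' x'"
      by (simp add: cinner_add_left cinner_add_right cinner_scaleC_left cinner_scaleC_right
          s' s_def algebra_simps)
    also have "cnj c * s + c * cnj s = of_real (- 2 * t * (cmod s)\<^sup>2)"
      unfolding cmod_power2 by (simp add: c_def complex_eq_iff algebra_simps power2_eq_square)
    also have "c * cnj c = of_real (t\<^sup>2 * (cmod s)\<^sup>2)"
      unfolding cmod_power2 by (simp add: c_def complex_eq_iff algebra_simps power2_eq_square)
    finally show ?thesis
      by simp
  qed
  show ?thesis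
  proof (cases "Re (cinner y' x') = 0")
    case True
    have "(cmod s)\<^sup>2 = 0"
    proof (rule ccontr)
      assume "(cmod s)\<^sup>2 \<noteq> 0"
      \<comment> \<open>With q for \<open>Re (cinner y x)\<close>, which is nonnegative, this t
        turns the left side of \<open>ge\<close> into \<open>- q - 2\<close>.\<close>
      then show False
        using ge[of "(Re (cinner y x) + 1) / (cmod s)\<^sup>2"] D(6)[OF xy(1)] True
        by simp
    qed
    then show ?thesis
      using True by (simp add: s_def)
  next
    case False
    then have pos: "Re (cinner y' x') > 0"
      using D(6)[OF xy(2)] by simp
    \<comment> \<open>This t minimises the quadratic polynomial in \<open>ge\<close>.\<close>
    show ?thesis
      using ge[of "1 / Re (cinner y' x')"] pos
      by (simp add: s_def field_simps power2_eq_square)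
  qed
qed

lemma positive_op_Id: "positive_op UNIV (Id :: 'a::complex_inner rel)"
  unfolding positive_op_def linear_op_def densely_defined_def symmetric_op_def
  by (auto simp: cinner_self_nonneg single_valued_Id Domain_Id)

lemma cinner_Cauchy_Schwarz: "cmod (cinner x y) \<le> norm x * norm (y :: 'a::complex_inner)"
proof -
  have "(cmod (cinner x y))\<^sup>2 \<le> (norm x * norm y)\<^sup>2"
    using positive_op_Cauchy_Schwarz[OF positive_op_Id, of x x y y]
    by (simp add: power2_norm_eq_cinner power_mult_distrib)
  then show ?thesis
    by (rule power2_le_imp_le) simp
qed

interpretation cinner: bounded_bilinear "cinner :: 'a::complex_inner \<Rightarrow> 'a \<Rightarrow> complex"
proof
  show "\<exists>K. \<forall>a b :: 'a. norm (cinner a b) \<le> norm a * norm b * K"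
    by (intro exI[of _ 1]) (simp add: cinner_Cauchy_Schwarz)
qed (simp_all add: cinner_add_left cinner_add_right cinner_scaleR_left cinner_scaleR_right
    scaleR_conv_of_real)

lemma norm_scaleC: "norm (c *\<^sub>C x) = cmod c * norm (x :: 'a::complex_inner)"
proof -
  have "cinner (c *\<^sub>C x) (c *\<^sub>C x) = (c * cnj c) * cinner x x"
    by (simp add: cinner_scaleC_left cinner_scaleC_right)
  also have "\<dots> = of_real ((cmod c * norm x)\<^sup>2)"
    by (simp only: complex_norm_square[symmetric] cinner_self of_real_mult power_mult_distrib)
  finally have "(norm (c *\<^sub>C x))\<^sup>2 = (cmod c * norm x)\<^sup>2"
    by (simp only: cinner_self of_real_eq_iff)
  then show ?thesis
    by (rule power2_eq_imp_eq) simp_all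
qed

lemma bounded_linear_scaleC: "bounded_linear (\<lambda>x :: 'a::complex_inner. c *\<^sub>C x)"
  by (rule bounded_linear_intro[of _ "cmod c"])
    (simp_all add: scaleC_add_right scaleR_scaleC scaleC_scaleC norm_scaleC mult.commute)

lemmas scaleC_diff_right = bounded_linear.linear[OF bounded_linear_scaleC, THEN linear_diff]
  and tendsto_scaleC = bounded_linear.tendsto[OF bounded_linear_scaleC]

declare cinner.zero_left [simp] cinner.zero_right [simp]

lemma cinner_eqI:
  assumes "\<And>x. cinner x y = cinner x (z :: 'a::complex_inner)"
  shows "y = z"
  using assms[of "y - z"] cinner_self_eq_zero_iff[of "y - z"] by (simp add: cinner.diff_right)

lemma power2_norm_add:
  "(norm (x + y))\<^sup>2 = (norm x)\<^sup>2 + (norm y)\<^sup>2 + 2 * Re (cinner x (y :: 'a::complex_inner))"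
  using arg_cong[OF cinner_commute[of x y], of Re]
  by (simp add: power2_norm_eq_cinner cinner_add_left cinner_add_right)

lemma power2_norm_diff:
  "(norm (x - y))\<^sup>2 = (norm x)\<^sup>2 + (norm y)\<^sup>2 - 2 * Re (cinner x (y :: 'a::complex_inner))"
  using power2_norm_add[of x "- y"] by (simp add: cinner.minus_right)

section \<open>Orthogonal projections and adjoints\<close>

definition csubspace :: "'a::complex_inner set \<Rightarrow> bool"
  where "csubspace M \<longleftrightarrow> 0 \<in> M \<and> (\<forall>x\<in>M. \<forall>y\<in>M. x + y \<in> M) \<and> (\<forall>c. \<forall>x\<in>M. c *\<^sub>C x \<in> M)"

lemma csubspaceD:
  assumes "csubspace M"
  shows "0 \<in> M" "x \<in> M \<Longrightarrow> y \<in> M \<Longrightarrow> x + y \<in> M" "x \<in> M \<Longrightarrow> c *\<^sub>C x \<in> M"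
    "x \<in> M \<Longrightarrow> y \<in> M \<Longrightarrow> x - y \<in> M" "x \<in> M \<Longrightarrow> r *\<^sub>R x \<in> M"
proof -
  show "0 \<in> M" and add: "\<And>x y. x \<in> M \<Longrightarrow> y \<in> M \<Longrightarrow> x + y \<in> M"
    and sc: "\<And>x c. x \<in> M \<Longrightarrow> c *\<^sub>C x \<in> M"
    using assms by (auto simp: csubspace_def)
  show "x \<in> M \<Longrightarrow> r *\<^sub>R x \<in> M"
    using sc by (simp add: scaleR_scaleC)
  show "x \<in> M \<Longrightarrow> y \<in> M \<Longrightarrow> x - y \<in> M"
    using add[of x "- y"] sc[of y "-1"] by (simp add: scaleC_minus_one)
qed

lemma orthoD: "x \<in> M \<Longrightarrow> y \<in> ortho M \<Longrightarrow> cinner x y = 0"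
  by (simp add: ortho_def)

lemma orthoD': "x \<in> M \<Longrightarrow> y \<in> ortho M \<Longrightarrow> cinner y x = 0"
  using orthoD cinner_commute by (metis complex_cnj_zero)

lemma csubspace_ortho: "csubspace (ortho M)"
  by (simp add: csubspace_def ortho_def cinner_add_right cinner_scaleC_right)

lemma closed_ortho: "closed (ortho M)"
proof -
  have "ortho M = (\<Inter>x\<in>M. {y. cinner x y = 0})"
    by (auto simp: ortho_def)
  moreover have "closed {y. cinner x y = 0}" for x :: 'a
    by (intro closed_Collect_eq continuous_intros cinner.continuous_on)
  ultimately show ?thesis
    by auto
qed

lemma csubspace_closure:
  assumes "csubspace M"
  shows "csubspace (closure M)"
  unfolding csubspace_def
proof (intro conjI ballI allI)
  show "0 \<in> closure M"
    using csubspaceD(1)[OF assms] closure_subset by blast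
next
  fix x y assume "x \<in> closure M" "y \<in> closure M"
  then obtain f g where "\<forall>n. f n \<in> M" "f \<longlonglongrightarrow> x" "\<forall>n. g n \<in> M" "g \<longlonglongrightarrow> y"
    by (auto simp: closure_sequential)
  then show "x + y \<in> closure M"
    unfolding closure_sequential
    by (intro exI[of _ "\<lambda>n. f n + g n"]) (auto intro: tendsto_add csubspaceD[OF assms])
next
  fix x c assume "x \<in> closure M"
  then obtain f where "\<forall>n. f n \<in> M" "f \<longlonglongrightarrow> x"
    by (auto simp: closure_sequential)
  then show "c *\<^sub>C x \<in> closure M"
    unfolding closure_sequential
    by (intro exI[of _ "\<lambda>n. c *\<^sub>C f n"]) (auto intro: tendsto_scaleC csubspaceD[OF assms])
qed

text \<open>A minimising sequence is Cauchy: midpoints stay in \<open>M\<close>, so by the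
  parallelogram identity two points that nearly attain the infimum are close to each other. The
  infimum is taken over squared distances because that identity is linear in them.\<close>

lemma ex_nearest_point:
  fixes x :: "'a::chilbert_space"
  assumes M: "csubspace M" "closed M"
  shows "\<exists>y\<in>M. \<forall>z\<in>M. norm (x - y) \<le> norm (x - z)"
proof -
  define d where "d = (INF z\<in>M. (norm (x - z))\<^sup>2)"
  have M0: "M \<noteq> {}"
    using csubspaceD(1)[OF M(1)] by auto
  have bdd: "bdd_below ((\<lambda>z. (norm (x - z))\<^sup>2) ` M)"
    by (rule bdd_belowI2[of _ 0]) simp
  have d_le: "d \<le> (norm (x - z))\<^sup>2" if "z \<in> M" for z
    unfolding d_def using bdd that by (rule cINF_lower)
  have "\<exists>y\<in>M. (norm (x - y))\<^sup>2 < d + 1 / Suc n" for n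
    using cINF_less_iff[OF M0 bdd, of "d + 1 / Suc n"] by (simp add: d_def)
  then obtain y where y: "\<And>n. y n \<in> M" "\<And>n. (norm (x - y n))\<^sup>2 < d + 1 / Suc n"
    by metis
  have dist: "(norm (y m - y n))\<^sup>2 \<le> 2 / Suc m + 2 / Suc n" for m n
  proof -
    have half: "(1/2) *\<^sub>R (y m + y n) \<in> M"
      by (intro csubspaceD[OF M(1)] y)
    have "(norm (y m - y n))\<^sup>2 + (norm ((x - y m) + (x - y n)))\<^sup>2
        = 2 * (norm (x - y m))\<^sup>2 + 2 * (norm (x - y n))\<^sup>2"
      using power2_norm_diff[of "x - y n" "x - y m"] power2_norm_add[of "x - y n" "x - y m"]
      by (simp add: algebra_simps)
    moreover have "(x - y m) + (x - y n) = 2 *\<^sub>R (x - (1/2) *\<^sub>R (y m + y n))"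
      by (simp add: algebra_simps scaleR_2)
    then have "(norm ((x - y m) + (x - y n)))\<^sup>2 \<ge> 4 * d"
      using d_le[OF half] by (simp add: power_mult_distrib)
    ultimately show ?thesis
      using y(2)[of m] y(2)[of n] by simp
  qed
  have "Cauchy y"
  proof (rule metric_CauchyI)
    fix e :: real assume e: "e > 0"
    obtain N where N: "1 / Suc N < e\<^sup>2 / 4"
      using nat_approx_posE[of "e\<^sup>2 / 4"] e by auto
    show "\<exists>N. \<forall>m\<ge>N. \<forall>n\<ge>N. dist (y m) (y n) < e"
    proof (intro exI[of _ N] allI impI)
      fix m n assume mn: "m \<ge> N" "n \<ge> N"
      have "1 / Suc m \<le> 1 / Suc N" "1 / Suc n \<le> 1 / Suc N"
        using mn by (simp_all add: frac_le)
      then have "(norm (y m - y n))\<^sup>2 < e\<^sup>2"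
        using dist[of m n] N by simp
      then show "dist (y m) (y n) < e"
        using e by (simp add: dist_norm power_less_imp_less_base)
    qed
  qed
  then obtain l where l: "y \<longlonglongrightarrow> l"
    using Cauchy_convergent convergent_def by blast
  have "(norm (x - l))\<^sup>2 \<le> d"
  proof (rule tendsto_le[OF sequentially_bot])
    show "(\<lambda>n. (norm (x - y n))\<^sup>2) \<longlonglongrightarrow> (norm (x - l))\<^sup>2"
      by (intro tendsto_intros l)
    show "(\<lambda>n. d + 1 / Suc n) \<longlonglongrightarrow> d"
      using tendsto_add[OF tendsto_const LIMSEQ_inverse_real_of_nat, of d]
      by (simp add: inverse_eq_divide)
    show "\<forall>\<^sub>F n in sequentially. (norm (x - y n))\<^sup>2 \<le> d + 1 / Suc n"
      using y(2) by (intro always_eventually allI less_imp_le)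
  qed
  then have "norm (x - l) \<le> norm (x - z)" if "z \<in> M" for z
    using order.trans[OF _ d_le[OF that]] by (blast intro: power2_le_imp_le norm_ge_zero)
  then show ?thesis
    using closed_sequentially[OF M(2) _ l] y(1) by blast
qed

lemma ex_orthogonal_decomposition:
  fixes x :: "'a::chilbert_space"
  assumes M: "csubspace M" "closed M"
  shows "\<exists>y\<in>M. x - y \<in> ortho M"
proof -
  obtain y where y: "y \<in> M" and near: "\<And>z. z \<in> M \<Longrightarrow> norm (x - y) \<le> norm (x - z)"
    using ex_nearest_point[OF M] by metis
  have "cinner z (x - y) = 0" if z: "z \<in> M" for z
  proof (rule ccontr)
    define s where "s = cinner (x - y) z"
    assume "cinner z (x - y) \<noteq> 0"
    then have s: "s \<noteq> 0" and z0: "z \<noteq> 0"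
      using cinner_commute[of z "x - y"] by (auto simp: s_def)
    \<comment> \<open>The multiple of z nearest to \<open>x - y\<close>; subtracting it would lower
      the squared distance by \<open>(cmod s)\<^sup>2 / (norm z)\<^sup>2\<close>, against the
      minimality of y.\<close>
    define c where "c = s / of_real ((norm z)\<^sup>2)"
    have "norm (x - y) \<le> norm ((x - y) - c *\<^sub>C z)"
      using near[of "y + c *\<^sub>C z"] y z csubspaceD[OF M(1)] by (simp add: diff_diff_eq)
    then have "2 * Re (cinner (x - y) (c *\<^sub>C z)) \<le> (norm (c *\<^sub>C z))\<^sup>2"
      using power2_norm_diff[of "x - y" "c *\<^sub>C z"] power_mono[of "norm (x - y)" _ 2] by fastforce
    moreover have "cinner (x - y) (c *\<^sub>C z) = of_real ((cmod s)\<^sup>2 / (norm z)\<^sup>2)"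
    proof -
      have "cinner (x - y) (c *\<^sub>C z) = s * cnj s / of_real ((norm z)\<^sup>2)"
        unfolding cinner_scaleC_right s_def[symmetric] by (simp add: c_def)
      then show ?thesis
        by (simp only: complex_norm_square[symmetric] of_real_divide)
    qed
    moreover have "(norm (c *\<^sub>C z))\<^sup>2 = (cmod s)\<^sup>2 / (norm z)\<^sup>2"
    proof -
      have "norm (c *\<^sub>C z) = cmod s / norm z"
        using z0 by (simp add: norm_scaleC c_def norm_divide norm_mult power2_eq_square)
      then show ?thesis
        by (simp add: power_divide)
    qed
    ultimately have "(cmod s)\<^sup>2 / (norm z)\<^sup>2 \<le> 0"
      by simp
    then show False
      using s z0 by (simp add: divide_le_0_iff)
  qed
  then show ?thesis
    using y by (auto simp: ortho_def)
qed

section \<open>Bounded complex-linear maps and the orthogonal projection\<close>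

definition bounded_clinear :: "('a::complex_inner \<Rightarrow> 'b::complex_inner) \<Rightarrow> bool"
  where "bounded_clinear f \<longleftrightarrow> bounded_linear f \<and> (\<forall>c x. f (c *\<^sub>C x) = c *\<^sub>C f x)"

lemma bounded_clinear_bounded_linear: "bounded_clinear f \<Longrightarrow> bounded_linear f"
  by (simp add: bounded_clinear_def)

lemmas bounded_clinear_simps =
  bounded_clinear_bounded_linear[THEN bounded_linear.linear, THEN linear_add]
  bounded_clinear_bounded_linear[THEN bounded_linear.linear, THEN linear_diff]
  bounded_clinear_bounded_linear[THEN bounded_linear.linear, THEN linear_0]
  bounded_clinear_bounded_linear[THEN bounded_linear.linear, THEN linear_neg]

lemma bounded_clinear_scaleC: "bounded_clinear f \<Longrightarrow> f (c *\<^sub>C x) = c *\<^sub>C f x"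
  by (simp add: bounded_clinear_def)

lemma bounded_clinear_tendsto:
  "bounded_clinear f \<Longrightarrow> (g \<longlongrightarrow> l) F \<Longrightarrow> ((\<lambda>x. f (g x)) \<longlongrightarrow> f l) F"
  by (rule bounded_linear.tendsto[OF bounded_clinear_bounded_linear])

lemma bounded_clinear_compose:
  "bounded_clinear f \<Longrightarrow> bounded_clinear g \<Longrightarrow> bounded_clinear (\<lambda>x. f (g x))"
  by (simp add: bounded_clinear_def bounded_linear_compose)

lemma bounded_clinear_diff:
  "bounded_clinear f \<Longrightarrow> bounded_clinear g \<Longrightarrow> bounded_clinear (\<lambda>x. f x - g x)"
  by (simp add: bounded_clinear_def bounded_linear_sub scaleC_diff_right)

lemma bounded_clinearI:
  assumes "\<And>x y. f (x + y) = f x + f y" "\<And>c x. f (c *\<^sub>C x) = c *\<^sub>C f x"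
    "\<And>x. norm (f x) \<le> norm x * K"
  shows "bounded_clinear f"
  unfolding bounded_clinear_def
  using assms by (auto intro!: bounded_linear_intro[of f K] simp: scaleR_scaleC)

definition proj :: "'a::chilbert_space set \<Rightarrow> 'a \<Rightarrow> 'a"
  where "proj M x = (SOME y. y \<in> M \<and> x - y \<in> ortho M)"

context
  fixes M :: "'a::chilbert_space set"
  assumes M: "csubspace M" "closed M"
begin

lemma proj_mem: "proj M x \<in> M" and diff_proj_mem: "x - proj M x \<in> ortho M"
proof -
  have "\<exists>y. y \<in> M \<and> x - y \<in> ortho M"
    using ex_orthogonal_decomposition[OF M, of x] by blast
  from someI_ex[OF this] show "proj M x \<in> M" "x - proj M x \<in> ortho M"
    by (auto simp: proj_def)
qed

lemma proj_unique:
  assumes "y \<in> M" "x - y \<in> ortho M"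
  shows "proj M x = y"
proof -
  have "proj M x - y \<in> M"
    using assms proj_mem csubspaceD(4)[OF M(1)] by blast
  moreover have "proj M x - y \<in> ortho M"
    using csubspaceD(4)[OF csubspace_ortho assms(2) diff_proj_mem[of x]] by simp
  ultimately have "cinner (proj M x - y) (proj M x - y) = 0"
    by (rule orthoD)
  then show ?thesis
    by (simp add: cinner_self_eq_zero_iff)
qed

lemma proj_on: "x \<in> M \<Longrightarrow> proj M x = x"
  by (rule proj_unique) (auto simp: csubspaceD[OF csubspace_ortho])

lemma proj_ortho: "x \<in> ortho M \<Longrightarrow> proj M x = 0"
  by (rule proj_unique) (auto simp: csubspaceD[OF M(1)])

lemma cinner_proj: "cinner (proj M x) y = cinner x (proj M y)"
proof -
  have "cinner (proj M x) (y - proj M y) = 0" "cinner (x - proj M x) (proj M y) = 0"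
    by (rule orthoD[OF proj_mem diff_proj_mem], rule orthoD'[OF proj_mem diff_proj_mem])
  then show ?thesis
    by (simp add: cinner.diff_left cinner.diff_right)
qed

lemma power2_norm_proj: "(norm x)\<^sup>2 = (norm (proj M x))\<^sup>2 + (norm (x - proj M x))\<^sup>2"
  using power2_norm_add[of "proj M x" "x - proj M x"] orthoD[OF proj_mem diff_proj_mem]
  by simp

lemma norm_proj_le: "norm (proj M x) \<le> norm x"
  by (rule power2_le_imp_le) (simp_all add: power2_norm_proj[of x])

lemma bounded_clinear_proj: "bounded_clinear (proj M)"
proof (rule bounded_clinearI)
  show "proj M (x + y) = proj M x + proj M y" for x y
  proof (rule proj_unique)
    show "x + y - (proj M x + proj M y) \<in> ortho M"
      using csubspaceD(2)[OF csubspace_ortho diff_proj_mem[of x] diff_proj_mem[of y]]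
      by (simp only: add_diff_add)
  qed (rule csubspaceD(2)[OF M(1) proj_mem proj_mem])
  show "proj M (c *\<^sub>C x) = c *\<^sub>C proj M x" for c x
  proof (rule proj_unique)
    show "c *\<^sub>C x - c *\<^sub>C proj M x \<in> ortho M"
      using csubspaceD(3)[OF csubspace_ortho diff_proj_mem[of x], of c]
      by (simp only: scaleC_diff_right)
  qed (rule csubspaceD(3)[OF M(1) proj_mem])
  show "norm (proj M x) \<le> norm x * 1" for x
    by (simp add: norm_proj_le)
qed

lemma ortho_ortho: "ortho (ortho M) = M"
proof
  show "M \<subseteq> ortho (ortho M)"
    by (auto simp: ortho_def[of "ortho M"] intro: orthoD')
  show "ortho (ortho M) \<subseteq> M"
  proof
    fix x assume x: "x \<in> ortho (ortho M)"
    have "proj M x \<in> ortho (ortho M)"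
      using \<open>M \<subseteq> _\<close> proj_mem by blast
    then have "x - proj M x \<in> ortho (ortho M)"
      by (rule csubspaceD(4)[OF csubspace_ortho x])
    then have "cinner (x - proj M x) (x - proj M x) = 0"
      by (rule orthoD[OF diff_proj_mem])
    then have "proj M x = x"
      by (simp add: cinner_self_eq_zero_iff)
    then show "x \<in> M"
      using proj_mem[of x] by simp
  qed
qed

end

text \<open>The complement of the kernel \<open>K\<close> is the line spanned by \<open>v\<close>:
  for every x the vector \<open>f v *\<^sub>C x - f x *\<^sub>C v\<close> lies in \<open>K\<close>,
  and pairing it with \<open>v\<close> solves for \<open>f x\<close>. The coefficient is conjugated
  because \<open>cinner\<close> is antilinear in its second argument.\<close>

lemma Riesz_representation:
  fixes f :: "'a::chilbert_space \<Rightarrow> complex"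
  assumes f: "bounded_linear f" and fc: "\<And>c x. f (c *\<^sub>C x) = c * f x"
  shows "\<exists>z. \<forall>x. f x = cinner x z"
proof (cases "\<forall>x. f x = 0")
  case True
  then show ?thesis
    by (intro exI[of _ 0]) simp
next
  case False
  then obtain x0 where x0: "f x0 \<noteq> 0"
    by blast
  interpret f: bounded_linear f by (rule f)
  define K where "K = {x. f x = 0}"
  have K: "csubspace K" "closed K"
    unfolding K_def
    by (simp_all add: csubspace_def f.add f.zero fc closed_Collect_eq f.continuous_on)
  define v where "v = x0 - proj K x0"
  have v: "v \<in> ortho K"
    unfolding v_def by (rule diff_proj_mem[OF K])
  have fv: "f v \<noteq> 0"
    using proj_mem[OF K, of x0] x0 by (simp add: v_def f.diff K_def)
  then have v0: "cinner v v \<noteq> 0"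
    using f.zero by (auto simp: cinner_self_eq_zero_iff)
  show ?thesis
  proof (intro exI[of _ "cnj (f v / cinner v v) *\<^sub>C v"] allI)
    fix x
    have "f v *\<^sub>C x - f x *\<^sub>C v \<in> K"
      by (simp add: K_def f.diff fc)
    then have "cinner (f v *\<^sub>C x - f x *\<^sub>C v) v = 0"
      using v by (rule orthoD)
    then show "f x = cinner x (cnj (f v / cinner v v) *\<^sub>C v)"
      using v0 by (simp add: cinner.diff_left cinner_scaleC_left cinner_scaleC_right field_simps)
  qed
qed

section \<open>Adjoints of bounded operators on the whole space\<close>

definition adj :: "('a::chilbert_space \<Rightarrow> 'a) \<Rightarrow> 'a \<Rightarrow> 'a"
  where "adj f y = (SOME z. \<forall>x. cinner (f x) y = cinner x z)"

lemma cinner_adj: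
  fixes f :: "'a::chilbert_space \<Rightarrow> 'a"
  assumes f: "bounded_clinear f"
  shows "cinner (f x) y = cinner x (adj f y)"
proof -
  have "\<exists>z. \<forall>x. cinner (f x) y = cinner x z"
    by (rule Riesz_representation[OF bounded_linear_compose[OF cinner.bounded_linear_left
            bounded_clinear_bounded_linear[OF f]]])
      (simp add: bounded_clinear_scaleC[OF f] cinner_scaleC_left)
  from someI_ex[OF this] show ?thesis
    unfolding adj_def by blast
qed

lemma cinner_adj':
  "bounded_clinear f \<Longrightarrow> cinner (adj f y) x = cinner y (f (x :: 'a::chilbert_space))"
  using cinner_commute[of "adj f y" x] cinner_commute[of y "f x"] by (simp add: cinner_adj[of f])

lemma adj_unique:
  assumes "bounded_clinear f" "\<And>x. cinner (f x) y = cinner x z"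
  shows "adj f y = (z :: 'a::chilbert_space)"
  by (rule cinner_eqI) (simp only: cinner_adj[OF assms(1), symmetric] assms(2))

lemma norm_adj_le:
  fixes f :: "'a::chilbert_space \<Rightarrow> 'a"
  assumes f: "bounded_clinear f" and K: "\<And>x. norm (f x) \<le> norm x * K"
  shows "norm (adj f y) \<le> norm y * K"
proof (cases "adj f y = 0")
  case True
  then show ?thesis
    using order.trans[OF norm_ge_zero K[of y]] by simp
next
  case False
  have "(norm (adj f y))\<^sup>2 = Re (cinner (f (adj f y)) y)"
    by (simp add: power2_norm_eq_cinner cinner_adj[OF f])
  also have "\<dots> \<le> norm (f (adj f y)) * norm y"
    by (rule order.trans[OF complex_Re_le_cmod cinner_Cauchy_Schwarz])
  also have "\<dots> \<le> (norm (adj f y) * K) * norm y"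
    by (intro mult_right_mono K) simp
  finally show ?thesis
    using False by (simp add: power2_eq_square mult_ac)
qed

lemma bounded_clinear_adj:
  fixes f :: "'a::chilbert_space \<Rightarrow> 'a"
  assumes f: "bounded_clinear f"
  shows "bounded_clinear (adj f)"
proof -
  obtain K where K: "\<And>x. norm (f x) \<le> norm x * K"
    using bounded_linear.bounded[OF bounded_clinear_bounded_linear[OF f]] by blast
  show ?thesis
  proof (rule bounded_clinearI)
    show "adj f (x + y) = adj f x + adj f y" for x y
      by (rule adj_unique[OF f]) (simp add: cinner_add_right cinner_adj[OF f])
    show "adj f (c *\<^sub>C x) = c *\<^sub>C adj f x" for c x
      by (rule adj_unique[OF f]) (simp add: cinner_scaleC_right cinner_adj[OF f])
    show "norm (adj f x) \<le> norm x * K" for x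
      by (rule norm_adj_le[OF f K])
  qed
qed

lemma adj_adj:
  fixes f :: "'a::chilbert_space \<Rightarrow> 'a"
  assumes f: "bounded_clinear f"
  shows "adj (adj f) = f"
  by (rule ext, rule adj_unique[OF bounded_clinear_adj[OF f]]) (rule cinner_adj'[OF f])

section \<open>Square roots\<close>

text \<open>
  If \<open>Y\<close> is a fixed point of \<open>Y \<mapsto> (X + Y\<^sup>2) / 2\<close> then \<open>(I - Y)\<^sup>2 = I - X\<close>. For \<open>norm X \<le> 1\<close> the
  iteration from 0 is majorized by the same scalar iteration with X = 1.
\<close>

primrec sqrt_seq :: "('a::real_normed_vector \<Rightarrow>\<^sub>L 'a) \<Rightarrow> nat \<Rightarrow> 'a \<Rightarrow>\<^sub>L 'a"
  where "sqrt_seq X 0 = 0"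
  | "sqrt_seq X (Suc n) = (1/2) *\<^sub>R (X + (sqrt_seq X n o\<^sub>L sqrt_seq X n))"

primrec sqrt_maj :: "nat \<Rightarrow> real"
  where "sqrt_maj 0 = 0"
  | "sqrt_maj (Suc n) = (1 + (sqrt_maj n)\<^sup>2) / 2"

lemma sqrt_maj_bounds: "0 \<le> sqrt_maj n \<and> sqrt_maj n \<le> 1"
proof (induction n)
  case (Suc n)
  then have "(sqrt_maj n)\<^sup>2 \<le> 1"
    by (simp add: power_le_one)
  then show ?case
    by simp
qed simp

lemma norm_sqrt_seq:
  assumes "norm X \<le> 1"
  shows "norm (sqrt_seq X n) \<le> sqrt_maj n"
proof (induction n)
  case (Suc n)
  have "norm (sqrt_seq X n o\<^sub>L sqrt_seq X n) \<le> sqrt_maj n * sqrt_maj n"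
    using sqrt_maj_bounds[of n]
    by (intro order.trans[OF norm_blinfun_compose] mult_mono Suc) simp_all
  then have "norm (X + (sqrt_seq X n o\<^sub>L sqrt_seq X n)) \<le> 1 + sqrt_maj n * sqrt_maj n"
    using assms by (intro order.trans[OF norm_triangle_ineq] add_mono)
  then show ?case
    by (simp add: power2_eq_square)
qed simp

text \<open>The identity \<open>Y\<^sup>2 - Z\<^sup>2 = Y (Y - Z) + (Y - Z) Z\<close> holds without
  commuting Y and Z, and estimating its right side factor by factor gives
  \<open>y\<^sup>2 - z\<^sup>2\<close>, twice the increment of the majorant.\<close>

lemma norm_sqrt_seq_diff:
  assumes X: "norm X \<le> 1"
  shows "norm (sqrt_seq X (Suc n) - sqrt_seq X n) \<le> sqrt_maj (Suc n) - sqrt_maj n"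
proof (induction n)
  case 0
  then show ?case
    using X by simp
next
  case (Suc n)
  define Y Z where "Y = sqrt_seq X (Suc n)" and "Z = sqrt_seq X n"
  define y z where "y = sqrt_maj (Suc n)" and "z = sqrt_maj n"
  have IH: "norm (Y - Z) \<le> y - z"
    using Suc unfolding Y_def Z_def y_def z_def .
  have YZ: "norm Y \<le> y" "norm Z \<le> z" "0 \<le> y" "0 \<le> z"
    using norm_sqrt_seq[OF X] sqrt_maj_bounds unfolding Y_def Z_def y_def z_def by blast+
  have Y': "sqrt_seq X (Suc (Suc n)) = (1/2) *\<^sub>R (X + (Y o\<^sub>L Y))" and Y: "Y = (1/2) *\<^sub>R (X + (Z o\<^sub>L Z))"
    by (simp_all add: Y_def Z_def)
  have y': "sqrt_maj (Suc (Suc n)) = (1 + y\<^sup>2) / 2" and y: "y = (1 + z\<^sup>2) / 2"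
    by (simp_all add: y_def z_def)
  have "sqrt_seq X (Suc (Suc n)) - Y = (1/2) *\<^sub>R (X + (Y o\<^sub>L Y)) - (1/2) *\<^sub>R (X + (Z o\<^sub>L Z))"
    using Y' Y by simp
  also have "\<dots> = (1/2) *\<^sub>R ((Y o\<^sub>L (Y - Z)) + ((Y - Z) o\<^sub>L Z))"
    by (rule blinfun_eqI) (simp add: blinfun.bilinear_simps algebra_simps)
  also have "norm \<dots> \<le> (1/2) * (y * (y - z) + (y - z) * z)"
  proof -
    have "norm (Y o\<^sub>L (Y - Z)) \<le> y * (y - z)"
      using YZ IH by (intro order.trans[OF norm_blinfun_compose] mult_mono) simp_all
    moreover have "norm ((Y - Z) o\<^sub>L Z) \<le> (y - z) * z"
      using YZ IH order.trans[OF norm_ge_zero IH]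
      by (intro order.trans[OF norm_blinfun_compose] mult_mono) simp_all
    ultimately show ?thesis
      using norm_triangle_ineq[of "Y o\<^sub>L (Y - Z)" "(Y - Z) o\<^sub>L Z"] by simp
  qed
  also have "\<dots> = (1 + y\<^sup>2) / 2 - (1 + z\<^sup>2) / 2"
    by (simp add: field_simps power2_eq_square)
  also have "\<dots> = sqrt_maj (Suc (Suc n)) - y"
    by (simp only: y' y[symmetric])
  finally show ?case
    by (simp only: Y_def y_def)
qed

lemma convergent_sqrt_seq:
  fixes X :: "'a::banach \<Rightarrow>\<^sub>L 'a"
  assumes X: "norm X \<le> 1"
  shows "convergent (sqrt_seq X)"
proof -
  \<comment> \<open>Monotonicity of the majorant is read off from \<open>norm_sqrt_seq_diff\<close>:
    its increments bound norms, here those for the operator 0 on the reals, and so are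
    nonnegative.\<close>
  have mono: "incseq sqrt_maj"
    using order.trans[OF norm_ge_zero norm_sqrt_seq_diff[of "0 :: real \<Rightarrow>\<^sub>L real"]]
    by (intro incseq_SucI) simp
  then have "convergent sqrt_maj"
    using sqrt_maj_bounds by (auto elim!: incseq_convergent[where B = 1] intro: convergentI)
  then obtain l where "sqrt_maj \<longlonglongrightarrow> l"
    by (auto simp: convergent_def)
  then have "summable (\<lambda>n. sqrt_maj (Suc n) - sqrt_maj n)"
    using telescope_sums sums_iff by blast
  then have "summable (\<lambda>n. sqrt_seq X (Suc n) - sqrt_seq X n)"
    using norm_sqrt_seq_diff[OF X] by (rule summable_comparison_test'[where N = 0])
  then have "convergent (\<lambda>n. \<Sum>i<n. sqrt_seq X (Suc i) - sqrt_seq X i)"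
    by (simp add: summable_iff_convergent)
  then show ?thesis
    by (simp add: sum_lessThan_telescope del: sqrt_seq.simps(2))
qed

text \<open>\<open>R\<close> is \<open>I - Y\<close> for the limit Y of the iterates. Every iterate
  is a polynomial in X, so symmetry and commutation with f pass to the limit, and positivity follows
  from \<open>norm Y \<le> 1\<close>.\<close>

lemma ex_sqrt_one_minus:
  fixes X :: "'a::chilbert_space \<Rightarrow> 'a"
  assumes X: "bounded_clinear X" and sym: "\<And>x y. cinner (X x) y = cinner x (X y)"
    and le: "\<And>x. norm (X x) \<le> norm x"
  shows "\<exists>R. bounded_clinear R \<and> (\<forall>x. R (R x) = x - X x)
    \<and> (\<forall>x y. cinner (R x) y = cinner x (R y)) \<and> (\<forall>x. Re (cinner (R x) x) \<ge> 0)
    \<and> (\<forall>f. bounded_linear f \<longrightarrow> (\<forall>x. f (X x) = X (f x)) \<longrightarrow> (\<forall>x. f (R x) = R (f x)))"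
proof -
  define X' where "X' = Blinfun X"
  have X': "blinfun_apply X' = X"
    unfolding X'_def by (rule bounded_linear_Blinfun_apply[OF bounded_clinear_bounded_linear[OF X]])
  have norm_X': "norm X' \<le> 1"
    using le by (intro norm_blinfun_bound) (simp_all add: X')
  obtain Y where Y: "sqrt_seq X' \<longlonglongrightarrow> Y"
    using convergent_sqrt_seq[OF norm_X'] by (auto simp: convergent_def)
  have fix_Y: "Y = (1/2) *\<^sub>R (X' + (Y o\<^sub>L Y))"
  proof (rule LIMSEQ_unique)
    show "(\<lambda>n. sqrt_seq X' (Suc n)) \<longlonglongrightarrow> Y"
      using Y by (rule LIMSEQ_Suc)
    show "(\<lambda>n. sqrt_seq X' (Suc n)) \<longlonglongrightarrow> (1/2) *\<^sub>R (X' + (Y o\<^sub>L Y))"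
      unfolding sqrt_seq.simps
      by (intro tendsto_intros bounded_bilinear.tendsto[OF bounded_bilinear_blinfun_compose] Y)
  qed
  have norm_Y: "norm Y \<le> 1"
    using sqrt_maj_bounds norm_sqrt_seq[OF norm_X']
    by (intro LIMSEQ_le_const2[OF tendsto_norm[OF Y]]) (meson order.trans)
  have lim: "(\<lambda>n. sqrt_seq X' n x) \<longlonglongrightarrow> Y x" for x
    by (intro tendsto_intros Y)
  have comm_Y: "f (Y x) = Y (f x)" if f: "bounded_linear f" and fX: "\<forall>x. f (X x) = X (f x)" for f x
  proof -
    interpret f: bounded_linear f by (rule f)
    have "f (sqrt_seq X' n x) = sqrt_seq X' n (f x)" for n x
      by (induction n arbitrary: x)
        (simp_all add: f.zero f.add f.scaleR fX X' blinfun.bilinear_simps)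
    then have "(\<lambda>n. sqrt_seq X' n (f x)) \<longlonglongrightarrow> f (Y x)"
      using f.tendsto[OF lim] by simp
    then show ?thesis
      using lim LIMSEQ_unique by blast
  qed
  have sym_Y: "cinner (Y x) y = cinner x (Y y)" for x y
  proof -
    have "cinner (sqrt_seq X' n x) y = cinner x (sqrt_seq X' n y)" for n x y
      by (induction n arbitrary: x y)
        (simp_all add: X' sym blinfun.bilinear_simps cinner_add_left cinner_add_right
          cinner_scaleR_left cinner_scaleR_right)
    then show ?thesis
      using LIMSEQ_unique[OF cinner.tendsto[OF lim tendsto_const] , of x y]
        cinner.tendsto[OF tendsto_const lim, of x y] by simp
  qed
  define R where "R = (\<lambda>x. x - Y x)"
  have comm_R: "f (R x) = R (f x)" if "bounded_linear f" "\<forall>x. f (X x) = X (f x)" for f x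
    using comm_Y[OF that] linear_diff[OF bounded_linear.linear[OF that(1)]] by (simp add: R_def)
  have "bounded_linear R"
    unfolding R_def by (intro bounded_linear_sub bounded_linear_ident blinfun.bounded_linear_right)
  \<comment> \<open>The iterates live in a type of real-linear maps; complex linearity of
    \<open>R\<close> is the commutation clause with f a scalar multiplication, which commutes with
    X.\<close>
  then have "bounded_clinear R"
    using comm_R[OF bounded_linear_scaleC] bounded_clinear_scaleC[OF X]
    unfolding bounded_clinear_def by metis
  moreover have "R (R x) = x - X x" for x
  proof -
    have "X x = 2 *\<^sub>R Y x - Y (Y x)"
      using arg_cong[OF fix_Y, of "\<lambda>Z. 2 *\<^sub>R blinfun_apply Z x"]
      by (simp add: X' blinfun.bilinear_simps)
    then show ?thesis
      by (simp add: R_def blinfun.bilinear_simps scaleR_2)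
  qed
  moreover have "cinner (R x) y = cinner x (R y)" for x y
    by (simp add: R_def cinner.diff_left cinner.diff_right sym_Y)
  moreover have "Re (cinner (R x) x) \<ge> 0" for x
  proof -
    have "Re (cinner (Y x) x) \<le> norm (Y x) * norm x"
      by (rule order.trans[OF complex_Re_le_cmod cinner_Cauchy_Schwarz])
    also have "\<dots> \<le> norm x * norm x"
      using norm_blinfun[of Y x] norm_Y mult_right_mono[OF norm_Y, of "norm x"]
      by (intro mult_right_mono) auto
    finally show ?thesis
      by (simp add: R_def cinner.diff_left cinner_self power2_eq_square)
  qed
  ultimately show ?thesis
    using comm_R by blast
qed

section \<open>Bounded operators between closed subspaces\<close>

definition gr :: "'a set \<Rightarrow> ('a \<Rightarrow> 'b) \<Rightarrow> ('a \<times> 'b) set"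
  where "gr M f = (\<lambda>x. (x, f x)) ` M"

lemma gr_iff [simp]: "(x, y) \<in> gr M f \<longleftrightarrow> x \<in> M \<and> y = f x"
  by (auto simp: gr_def)

lemma Domain_gr [simp]: "Domain (gr M f) = M"
  by (auto simp: Domain_iff)

lemma Range_gr [simp]: "Range (gr M f) = f ` M"
  by (auto simp: gr_def)

lemma gr_eq_iff: "gr M f = gr M g \<longleftrightarrow> (\<forall>x\<in>M. f x = g x)"
  by (auto simp: set_eq_iff)

lemma Id_on_gr: "Id_on M = gr M (\<lambda>x. x)"
  by (auto simp: gr_def)

lemma relcomp_gr: "(\<And>x. x \<in> M \<Longrightarrow> f x \<in> N) \<Longrightarrow> gr M f O gr N g = gr M (\<lambda>x. g (f x))"
  by (auto simp: gr_def)

lemma op_plus_gr: "gr M f \<oplus>\<^sub>o gr M g = gr M (\<lambda>x. f x + g x)"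
  by (auto simp: op_plus_def)

lemma op_minus_gr: "gr M f \<ominus>\<^sub>o gr M g = gr M (\<lambda>x. f x - g x)"
  by (auto simp: op_minus_def)

lemma op_uminus_gr: "op_uminus (gr M f) = gr M (\<lambda>x. - f x)"
  by (auto simp: op_uminus_def)

text \<open>
  A bounded operator from M to N is represented by the function on the whole space that vanishes
  on the orthogonal complement of M.
\<close>

definition op_fun :: "'a::chilbert_space set \<Rightarrow> 'a set \<Rightarrow> ('a \<Rightarrow> 'a) \<Rightarrow> bool"
  where "op_fun M N f \<longleftrightarrow> bounded_clinear f \<and> (\<forall>x. f x \<in> N) \<and> (\<forall>x. f (proj M x) = f x)"

lemma op_funD:
  assumes "op_fun M N f"
  shows "bounded_clinear f" "f x \<in> N" "f (proj M x) = f x"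
  using assms by (auto simp: op_fun_def)

lemma csubspace_UNIV: "csubspace UNIV"
  by (simp add: csubspace_def)

lemma linear_op_gr:
  assumes "bounded_clinear f" "csubspace M"
  shows "linear_op (gr M f)"
  unfolding linear_op_def
  using csubspaceD[OF assms(2)] bounded_clinear_simps[OF assms(1)] bounded_clinear_scaleC[OF assms(1)]
  by (auto simp: single_valued_def)

lemma csubspace_image:
  assumes "bounded_clinear f" "csubspace M"
  shows "csubspace (f ` M)"
  unfolding csubspace_def
proof (intro conjI ballI allI)
  show "0 \<in> f ` M"
    using bounded_clinear_simps(3)[OF assms(1)] csubspaceD(1)[OF assms(2)] by (metis imageI)
next
  fix x y assume "x \<in> f ` M" "y \<in> f ` M"
  then show "x + y \<in> f ` M"
    using bounded_clinear_simps(1)[OF assms(1)] csubspaceD(2)[OF assms(2)] by (auto simp: image_iff) metis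
next
  fix x c assume "x \<in> f ` M"
  then show "c *\<^sub>C x \<in> f ` M"
    using bounded_clinear_scaleC[OF assms(1)] csubspaceD(3)[OF assms(2)] by (auto simp: image_iff) metis
qed

lemma csubspace_Domain: "linear_op X \<Longrightarrow> csubspace (Domain X)"
  using linear_opD[of X] unfolding csubspace_def by (metis Domain_iff)

lemma contraction_bounded_op: "contraction M N X \<Longrightarrow> bounded_op M N X"
  unfolding contraction_def bounded_op_def by (auto intro!: exI[of _ 1])

context
  fixes M N :: "'a::chilbert_space set"
  assumes M: "csubspace M" "closed M" and N: "csubspace N" "closed N"
begin

lemma ex_op_fun:
  assumes X: "bounded_op M N X"
  shows "\<exists>f. op_fun M N f \<and> X = gr M f"
proof -
  have lin: "linear_op X" and dom: "Domain X = M" and ran: "Range X \<subseteq> N"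
    using X by (auto simp: bounded_op_def)
  note L = linear_opD[OF lin]
  obtain K where "\<forall>(x, y)\<in>X. norm y \<le> K * norm x"
    using X unfolding bounded_op_def by blast
  then have K: "(x, y) \<in> X \<Longrightarrow> norm y \<le> K * norm x" for x y
    by blast
  define f where "f x = (THE y. (proj M x, y) \<in> X)" for x
  have f: "(proj M x, y) \<in> X \<longleftrightarrow> y = f x" for x y
  proof -
    obtain y0 where y0: "(proj M x, y0) \<in> X"
      using dom proj_mem[OF M, of x] by blast
    then have "f x = y0"
      unfolding f_def by (rule the_equality) (rule single_valuedD[OF L(1) _ y0])
    then show ?thesis
      using y0 single_valuedD[OF L(1) _ y0] by blast
  qed
  have f': "(proj M x, f x) \<in> X" for x
    using f by blast
  have "bounded_clinear f"
  proof (rule bounded_clinearI)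
    show "f (x + y) = f x + f y" for x y
      using f[of "x + y" "f x + f y"] L(3)[OF f'[of x] f'[of y]]
      by (simp add: bounded_clinear_simps(1)[OF bounded_clinear_proj[OF M]])
    show "f (c *\<^sub>C x) = c *\<^sub>C f x" for c x
      using f[of "c *\<^sub>C x" "c *\<^sub>C f x"] L(4)[OF f'[of x], of c]
      by (simp add: bounded_clinear_scaleC[OF bounded_clinear_proj[OF M]])
    \<comment> \<open>The bound \<open>K\<close> in \<open>bounded_op\<close> has no prescribed
      sign, while replacing \<open>proj M x\<close> by \<open>x\<close> requires a nonnegative
      factor.\<close>
    show "norm (f x) \<le> norm x * \<bar>K\<bar>" for x
    proof -
      have "norm (f x) \<le> K * norm (proj M x)"
        by (rule K[OF f'])
      also have "\<dots> \<le> \<bar>K\<bar> * norm (proj M x)"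
        by (rule mult_right_mono[OF abs_ge_self norm_ge_zero])
      also have "\<dots> \<le> \<bar>K\<bar> * norm x"
        by (rule mult_left_mono[OF norm_proj_le[OF M] abs_ge_zero])
      finally show ?thesis
        by (simp add: mult.commute)
    qed
  qed
  moreover have "f x \<in> N" for x
    using f' ran by blast
  moreover have "f (proj M x) = f x" for x
    by (simp add: f_def proj_on[OF M proj_mem[OF M]])
  moreover have "X = gr M f"
  proof -
    have "(x, y) \<in> X \<longleftrightarrow> (x, y) \<in> gr M f" for x y
      using f[of x y] dom proj_on[OF M, of x] by (cases "x \<in> M") auto
    then show ?thesis
      by (simp add: set_eq_iff)
  qed
  ultimately show ?thesis
    unfolding op_fun_def by blast
qed

lemma norm_op_fun_le:
  assumes f: "op_fun M N f" and X: "contraction M N (gr M f)"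
  shows "norm (f x) \<le> norm x"
proof -
  have "norm (f (proj M x)) \<le> norm (proj M x)"
    using X proj_mem[OF M, of x] unfolding contraction_def by fastforce
  also have "\<dots> \<le> norm x"
    by (rule norm_proj_le[OF M])
  finally show ?thesis
    by (simp add: op_funD[OF f])
qed

lemma op_fun_compose:
  assumes "op_fun M N f" "op_fun N N' g"
  shows "op_fun M N' (\<lambda>x. g (f x))"
  using assms by (simp add: op_fun_def bounded_clinear_compose)

lemma contraction_gr:
  assumes f: "op_fun M N f" and le: "\<And>x. x \<in> M \<Longrightarrow> norm (f x) \<le> norm x"
  shows "contraction M N (gr M f)"
  using op_funD[OF f] le M by (auto simp: contraction_def linear_op_gr)

lemma op_fun_adj:
  assumes f: "op_fun M N f"
  shows "op_fun N M (adj f)"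
proof -
  note F = op_funD[OF f]
  have "adj f y \<in> M" for y
  proof -
    have "proj M (adj f y) = adj f y"
      by (rule adj_unique[OF F(1), symmetric]) (simp add: cinner_proj[OF M, symmetric] cinner_adj[OF F(1), symmetric] F)
    then show ?thesis
      using proj_mem[OF M, of "adj f y"] by simp
  qed
  moreover have "adj f (proj N y) = adj f y" for y
    by (rule adj_unique[OF F(1)])
      (simp add: cinner_proj[OF N, symmetric] cinner_adj[OF F(1), symmetric] proj_on[OF N] F)
  ultimately show ?thesis
    by (simp add: op_fun_def bounded_clinear_adj F)
qed

lemma bounded_op_gr:
  assumes f: "op_fun M N f"
  shows "bounded_op M N (gr M f)"
proof -
  obtain K where "\<And>x. norm (f x) \<le> norm x * K"
    using bounded_linear.bounded[OF bounded_clinear_bounded_linear[OF op_funD(1)[OF f]]] by blast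
  then have "\<forall>(x, y)\<in>gr M f. norm y \<le> K * norm x"
    by (simp add: split_beta gr_def mult.commute)
  then show ?thesis
    using op_funD[OF f] M by (auto simp: bounded_op_def linear_op_gr)
qed

text \<open>The relational adjoint tests only against vectors of M. Since f factors through the
  projection onto M and z lies in M, the test extends to all vectors, where it determines
  \<open>adj f y\<close>.\<close>

lemma op_adjoint_gr:
  assumes f: "op_fun M N f"
  shows "op_adjoint M N (gr M f) = gr N (adj f)"
proof -
  note F = op_funD[OF f] and A = op_funD[OF op_fun_adj[OF f]]
  have "z = adj f y" if "z \<in> M" "\<forall>(x, w)\<in>gr M f. cinner w y = cinner x z" for y z
  proof (rule adj_unique[OF F(1), symmetric])
    fix x
    have "cinner (f (proj M x)) y = cinner (proj M x) z"
      using that proj_mem[OF M] by force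
    then show "cinner (f x) y = cinner x z"
      using that by (simp add: F cinner_proj[OF M] proj_on[OF M])
  qed
  then show ?thesis
    by (auto simp: op_adjoint_def A cinner_adj[OF F(1)])
qed

end

section \<open>Positive square roots and defect operators on closed subspaces\<close>

lemma positive_op_gr:
  assumes "op_fun M M R" "csubspace M"
    and sym: "\<And>x y. cinner (R x) y = cinner x (R y)" and pos: "\<And>x. Re (cinner (R x) x) \<ge> 0"
  shows "positive_op M (gr M R)"
proof -
  have "cinner (R x) x \<in> \<real>\<^sub>\<ge>\<^sub>0" for x
    using pos[of x] arg_cong[OF cinner_commute[of "R x" x], of Im]
    by (simp add: complex_nonneg_Reals_iff sym)
  then show ?thesis
    using assms(1,2) op_funD[OF assms(1)] closure_subset[of M]
    by (auto simp: positive_op_def linear_op_gr densely_defined_def symmetric_op_def sym)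
qed

text \<open>Cauchy-Schwarz for the form of R, at \<open>y\<close> and \<open>R y\<close>, bounds the
  fourth power of \<open>norm (R y)\<close> by 0.\<close>

lemma positive_op_kernel:
  assumes R: "positive_op M (gr M R)" and M: "\<And>x. x \<in> M \<Longrightarrow> R x \<in> M"
    and y: "y \<in> M" "Re (cinner (R y) y) = 0"
  shows "R y = 0"
proof -
  have "(cmod (cinner (R y) (R y)))\<^sup>2 \<le> Re (cinner (R y) y) * Re (cinner (R (R y)) (R y))"
    by (rule positive_op_Cauchy_Schwarz[OF R]) (simp_all add: y M)
  then show ?thesis
    by (simp add: y cinner_self_eq_zero_iff)
qed

text \<open>For \<open>y = R x - R' x\<close> commutation gives
  \<open>(R + R') y = R\<^sup>2 x - R'\<^sup>2 x = 0\<close>. Both forms are nonnegative, so both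
  vanish at y, whence \<open>R y = R' y = 0\<close> and
  \<open><y, y> = <R y - R' y, x> = 0\<close>.\<close>

lemma pos_sqrt_unique:
  fixes R R' :: "'a::chilbert_space \<Rightarrow> 'a"
  assumes M: "csubspace M" and R: "op_fun M M R" and R': "op_fun M M R'"
    and pos: "positive_op M (gr M R)" "positive_op M (gr M R')"
    and sq: "\<And>x. x \<in> M \<Longrightarrow> R (R x) = R' (R' x)"
    and comm: "\<And>x. x \<in> M \<Longrightarrow> R' (R x) = R (R' x)" and x: "x \<in> M"
  shows "R x = R' x"
proof -
  note F = op_funD[OF R] and F' = op_funD[OF R']
  define y where "y = R x - R' x"
  have y: "y \<in> M"
    unfolding y_def using csubspaceD(4)[OF M] F(2) F'(2) by blast
  have "R y + R' y = 0"
    using sq[OF x] comm[OF x] by (simp add: y_def bounded_clinear_simps[OF F(1)] bounded_clinear_simps[OF F'(1)])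
  then have "Re (cinner (R y) y) + Re (cinner (R' y) y) = 0"
    by (metis cinner.zero_left cinner_add_left plus_complex.sel(1) zero_complex.sel(1))
  moreover have "Re (cinner (R y) y) \<ge> 0" "Re (cinner (R' y) y) \<ge> 0"
    using pos[THEN positive_opD(6)] y by simp_all
  ultimately have "R y = 0" "R' y = 0"
    using positive_op_kernel[OF pos(1) F(2) y] positive_op_kernel[OF pos(2) F'(2) y] by simp_all
  moreover have "cinner (R y) x = cinner y (R x)" "cinner (R' y) x = cinner y (R' x)"
    using pos[THEN positive_opD(4)] x y by simp_all
  ultimately have "cinner y y = 0"
    by (subst (2) y_def) (simp add: cinner.diff_right)
  then show ?thesis
    by (simp add: cinner_self_eq_zero_iff y_def)
qed

text \<open>\<open>pos_sqrt\<close> is a definite description, so every competing root r must be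
  excluded: r commutes with \<open>r\<^sup>2 = I - X\<close>, hence with X, hence with R, and
  \<open>pos_sqrt_unique\<close> applies. The commutation clause is passed on because it later
  yields \<open>A D = D A\<close>.\<close>

lemma pos_sqrt_one_minus:
  fixes X :: "'a::chilbert_space \<Rightarrow> 'a"
  assumes M: "csubspace M" "closed M" and X: "op_fun M M X"
    and sym: "\<And>x y. cinner (X x) y = cinner x (X y)" and le: "\<And>x. norm (X x) \<le> norm x"
  shows "\<exists>R. op_fun M M R \<and> pos_sqrt M (Id_on M \<ominus>\<^sub>o gr M X) = gr M R
    \<and> (\<forall>x\<in>M. R (R x) = x - X x) \<and> (\<forall>x y. cinner (R x) y = cinner x (R y))
    \<and> (\<forall>f. bounded_linear f \<longrightarrow> (\<forall>x. f x \<in> M) \<longrightarrow> (\<forall>x. f (X x) = X (f x)) \<longrightarrow>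
        (\<forall>x\<in>M. f (R x) = R (f x)))"
proof -
  note FX = op_funD[OF X]
  obtain Q where Q: "bounded_clinear Q" "\<And>x. Q (Q x) = x - X x"
    "\<And>x y. cinner (Q x) y = cinner x (Q y)" "\<And>x. Re (cinner (Q x) x) \<ge> 0"
    and Q_comm: "\<And>f x. bounded_linear f \<Longrightarrow> (\<And>x. f (X x) = X (f x)) \<Longrightarrow> f (Q x) = Q (f x)"
    using ex_sqrt_one_minus[OF FX(1) sym le] by metis
  have QM: "proj M (Q x) = Q (proj M x)" for x
    by (rule Q_comm[OF bounded_clinear_bounded_linear[OF bounded_clinear_proj[OF M]]])
      (simp add: FX proj_on[OF M])
  \<comment> \<open>On the orthogonal complement of M, where X is 0, the root Q of
    \<open>I - X\<close> acts as the identity; the projection cuts that part off.\<close>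
  define R where "R x = Q (proj M x)" for x
  have R_on: "R x = Q x" if "x \<in> M" for x
    using that by (simp add: R_def proj_on[OF M])
  have R_mem: "R x \<in> M" for x
    unfolding R_def QM[symmetric] by (rule proj_mem[OF M])
  have R: "op_fun M M R"
    unfolding op_fun_def using R_mem bounded_clinear_compose[OF Q(1) bounded_clinear_proj[OF M]]
    by (simp add: R_def[abs_def] proj_on[OF M proj_mem[OF M]])
  have RR: "R (R x) = x - X x" if "x \<in> M" for x
    using R_on[OF R_mem, of x] R_on[OF that] Q(2) by simp
  have R_sym: "cinner (R x) y = cinner x (R y)" for x y
    unfolding R_def by (simp only: Q(3) cinner_proj[OF M] QM)
  have R_pos: "Re (cinner (R x) x) \<ge> 0" for x
  proof -
    have "cinner (R x) x = cinner (proj M (Q (proj M x))) x"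
      by (simp add: R_def QM proj_on[OF M proj_mem[OF M]])
    then show ?thesis
      by (simp add: cinner_proj[OF M] Q(4))
  qed
  have R_comm: "f (R x) = R (f x)"
    if f: "bounded_linear f" "\<And>x. f (X x) = X (f x)" and fM: "\<And>x. f x \<in> M" and x: "x \<in> M" for f x
    using Q_comm[OF f] fM x by (simp add: R_on)
  have posR: "positive_op M (gr M R)"
    by (rule positive_op_gr[OF R M(1) R_sym R_pos])
  have "pos_sqrt M (Id_on M \<ominus>\<^sub>o gr M X) = gr M R"
    unfolding pos_sqrt_def
  proof (rule the_equality)
    show "bounded_op M M (gr M R) \<and> positive_op M (gr M R) \<and> gr M R O gr M R = Id_on M \<ominus>\<^sub>o gr M X"
      by (simp add: posR bounded_op_gr[OF M M R] relcomp_gr R_mem Id_on_gr op_minus_gr gr_eq_iff RR)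
  next
    fix Y assume Y: "bounded_op M M Y \<and> positive_op M Y \<and> Y O Y = Id_on M \<ominus>\<^sub>o gr M X"
    then obtain r where r: "op_fun M M r" and Yr: "Y = gr M r"
      using ex_op_fun[OF M M] by blast
    note Fr = op_funD[OF r]
    have rr: "r (r x) = x - X x" if "x \<in> M" for x
      using Y that unfolding Yr by (auto simp: relcomp_gr Fr Id_on_gr op_minus_gr gr_eq_iff)
    have "r (X x) = X (r x)" for x
    proof -
      have "X (proj M x) = proj M x - r (r (proj M x))"
        by (simp add: rr proj_mem[OF M])
      then have "r (X x) = r (proj M x - r (r (proj M x)))"
        by (simp add: FX)
      also have "\<dots> = r x - r (r (r x))"
        by (simp add: bounded_clinear_simps[OF Fr(1)] Fr)
      also have "\<dots> = X (r x)"
        by (simp add: rr Fr)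
      finally show ?thesis .
    qed
    then have comm: "r (R x) = R (r x)" if "x \<in> M" for x
      using R_comm[OF bounded_clinear_bounded_linear[OF Fr(1)] _ Fr(2) that] by blast
    have "r x = R x" if "x \<in> M" for x
      using pos_sqrt_unique[OF M(1) R r posR _ _ comm that] Y RR rr unfolding Yr by auto
    then show "Y = gr M R"
      by (simp add: Yr gr_eq_iff)
  qed
  then show ?thesis
    using R RR R_sym R_comm by blast
qed

lemma ex_defect_op:
  assumes M: "csubspace M" "closed M" and N: "csubspace N" "closed N"
    and f: "op_fun M N f" and le: "\<And>x. norm (f x) \<le> norm x"
  shows "\<exists>D. defect_op M N (gr M f) = gr M D \<and> op_fun M M D
    \<and> (\<forall>x\<in>M. D (D x) = x - adj f (f x)) \<and> (\<forall>x y. cinner (D x) y = cinner x (D y))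
    \<and> (\<forall>g. bounded_linear g \<longrightarrow> (\<forall>x. g x \<in> M) \<longrightarrow> (\<forall>x. g (adj f (f x)) = adj f (f (g x))) \<longrightarrow>
        (\<forall>x\<in>M. g (D x) = D (g x)))"
proof -
  note F = op_funD[OF f]
  have "gr M f O op_adjoint M N (gr M f) = gr M (\<lambda>x. adj f (f x))"
    by (simp add: op_adjoint_gr[OF M N f] relcomp_gr F)
  moreover have "op_fun M M (\<lambda>x. adj f (f x))"
    by (rule op_fun_compose[OF M N f op_fun_adj[OF M N f]])
  moreover have "cinner (adj f (f x)) y = cinner x (adj f (f y))" for x y
    by (simp add: cinner_adj[OF F(1), symmetric] cinner_adj'[OF F(1)])
  moreover have "norm (adj f (f x)) \<le> norm x" for x
    using norm_adj_le[OF F(1), of 1 "f x"] order.trans[OF _ le[of x]] le by simp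
  ultimately show ?thesis
    unfolding defect_op_def using pos_sqrt_one_minus[OF M, of "\<lambda>x. adj f (f x)"] by metis
qed

text \<open>Extension by continuity, carried out on graphs. The norm bound survives limits, which
  makes the closure single-valued; it also makes the images of a convergent sequence Cauchy, so by
  completeness the domain becomes closed.\<close>

lemma contraction_closure:
  fixes G :: "'a::chilbert_space rel"
  assumes G: "(0, 0) \<in> G" "\<And>x y x' y'. (x, y) \<in> G \<Longrightarrow> (x', y') \<in> G \<Longrightarrow> (x + x', y + y') \<in> G"
      "\<And>c x y. (x, y) \<in> G \<Longrightarrow> (c *\<^sub>C x, c *\<^sub>C y) \<in> G"
    and le: "\<And>x y. (x, y) \<in> G \<Longrightarrow> norm y \<le> norm x"
    and N: "Range G \<subseteq> N" "closed N"
  shows "contraction (closure (Domain G)) N (closure G)"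
proof -
  have cl: "(x, y) \<in> closure G \<longleftrightarrow> (\<exists>u v. (\<forall>n. (u n, v n) \<in> G) \<and> u \<longlonglongrightarrow> x \<and> v \<longlonglongrightarrow> y)" for x y
  proof
    assume "(x, y) \<in> closure G"
    then obtain p where "\<forall>n. p n \<in> G" "p \<longlonglongrightarrow> (x, y)"
      by (auto simp: closure_sequential)
    then show "\<exists>u v. (\<forall>n. (u n, v n) \<in> G) \<and> u \<longlonglongrightarrow> x \<and> v \<longlonglongrightarrow> y"
      using tendsto_fst[of p "(x, y)"] tendsto_snd[of p "(x, y)"]
      by (intro exI[of _ "\<lambda>n. fst (p n)"] exI[of _ "\<lambda>n. snd (p n)"]) simp
  next
    assume "\<exists>u v. (\<forall>n. (u n, v n) \<in> G) \<and> u \<longlonglongrightarrow> x \<and> v \<longlonglongrightarrow> y"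
    then show "(x, y) \<in> closure G"
      by (auto simp: closure_sequential intro: tendsto_Pair)
  qed
  have add: "(x + x', y + y') \<in> closure G" if xy: "(x, y) \<in> closure G" "(x', y') \<in> closure G" for x y x' y'
  proof -
    obtain u v u' v' where "\<forall>n. (u n, v n) \<in> G" "u \<longlonglongrightarrow> x" "v \<longlonglongrightarrow> y"
        "\<forall>n. (u' n, v' n) \<in> G" "u' \<longlonglongrightarrow> x'" "v' \<longlonglongrightarrow> y'"
      using xy unfolding cl by blast
    then show ?thesis
      unfolding cl by (intro exI[of _ "\<lambda>n. u n + u' n"] exI[of _ "\<lambda>n. v n + v' n"])
        (auto intro: G tendsto_add)
  qed
  have scale: "(c *\<^sub>C x, c *\<^sub>C y) \<in> closure G" if xy: "(x, y) \<in> closure G" for c x y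
  proof -
    obtain u v where "\<forall>n. (u n, v n) \<in> G" "u \<longlonglongrightarrow> x" "v \<longlonglongrightarrow> y"
      using xy unfolding cl by blast
    then show ?thesis
      unfolding cl by (intro exI[of _ "\<lambda>n. c *\<^sub>C u n"] exI[of _ "\<lambda>n. c *\<^sub>C v n"])
        (auto intro: G tendsto_scaleC)
  qed
  have norm_le: "norm y \<le> norm x" if xy: "(x, y) \<in> closure G" for x y
  proof -
    obtain u v where "\<forall>n. (u n, v n) \<in> G" "u \<longlonglongrightarrow> x" "v \<longlonglongrightarrow> y"
      using xy unfolding cl by blast
    then show ?thesis
      using le by (intro LIMSEQ_le[OF tendsto_norm tendsto_norm]) auto
  qed
  have "single_valued (closure G)"
  proof (rule single_valuedI)
    fix x y y' assume "(x, y) \<in> closure G" "(x, y') \<in> closure G"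
    then have "(x + (-1) *\<^sub>C x, y + (-1) *\<^sub>C y') \<in> closure G"
      by (intro add scale)
    from norm_le[OF this] show "y = y'"
      by (simp add: scaleC_minus_one)
  qed
  moreover have "Domain (closure G) = closure (Domain G)"
  proof (intro equalityI subsetI)
    fix x assume "x \<in> Domain (closure G)"
    then show "x \<in> closure (Domain G)"
      unfolding Domain_iff cl closure_sequential[of x] by fast
  next
    fix x assume "x \<in> closure (Domain G)"
    then obtain u where u: "\<forall>n. u n \<in> Domain G" "u \<longlonglongrightarrow> x"
      by (auto simp: closure_sequential)
    then have "\<forall>n. \<exists>y. (u n, y) \<in> G"
      by blast
    then obtain v where v: "\<And>n. (u n, v n) \<in> G"
      by metis
    have "norm (v m - v n) \<le> norm (u m - u n)" for m n
      using le[OF G(2)[OF v[of m] G(3)[OF v[of n], of "-1"]]] by (simp add: scaleC_minus_one)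
    then have "Cauchy v"
      using LIMSEQ_imp_Cauchy[OF u(2)] unfolding Cauchy_def dist_norm by (meson le_less_trans)
    then obtain y where "v \<longlonglongrightarrow> y"
      using Cauchy_convergent convergent_def by blast
    then show "x \<in> Domain (closure G)"
      unfolding Domain_iff cl using u v by blast
  qed
  moreover have "y \<in> N" if "(x, y) \<in> closure G" for x y
    using that N closed_sequentially[OF N(2)] unfolding cl by blast
  moreover have "(0, 0) \<in> closure G"
    using G(1) closure_subset by blast
  ultimately show ?thesis
    unfolding contraction_def linear_op_def using add scale norm_le by (fastforce)
qed

section \<open>The extension with parameter -I\<close>

lemma op_fun_ortho:
  assumes M: "csubspace M" "closed M" and f: "op_fun M N f" and x: "x \<in> ortho M"
  shows "f x = 0"
  using op_funD(3)[OF f, of x] by (simp add: proj_ortho[OF M x] bounded_clinear_simps[OF op_funD(1)[OF f]])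

text \<open>The contraction \<open>\<Gamma>\<^sub>2\<close> is the closure of the relation sending \<open>D\<^sub>A x\<close> to \<open>T x - A x\<close>.\<close>

lemma ex_factor_through_defect:
  fixes M :: "'a::chilbert_space set"
  assumes M: "csubspace M" "closed M" and N: "csubspace N" "closed N"
    and D: "bounded_clinear D" and b: "bounded_clinear b" and bN: "\<And>x. x \<in> M \<Longrightarrow> b x \<in> N"
    and le: "\<And>x. x \<in> M \<Longrightarrow> norm (b x) \<le> norm (D x)"
  shows "\<exists>g. op_fun (closure (D ` M)) N g \<and> contraction (closure (D ` M)) N (gr (closure (D ` M)) g)
    \<and> (\<forall>x\<in>M. g (D x) = b x)"
proof -
  define G where "G = (\<lambda>x. (D x, b x)) ` M"
  have E: "csubspace (closure (D ` M))" "closed (closure (D ` M))"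
    by (auto intro: csubspace_closure csubspace_image D M)
  have add: "(x + x', y + y') \<in> G" if xy: "(x, y) \<in> G" "(x', y') \<in> G" for x y x' y'
  proof -
    obtain z z' where "z \<in> M" "z' \<in> M" "x = D z" "y = b z" "x' = D z'" "y' = b z'"
      using xy by (auto simp: G_def)
    then show ?thesis
      unfolding G_def
      by (intro image_eqI[of _ _ "z + z'"])
        (simp_all add: bounded_clinear_simps[OF D] bounded_clinear_simps[OF b] csubspaceD[OF M(1)])
  qed
  have scale: "(c *\<^sub>C x, c *\<^sub>C y) \<in> G" if xy: "(x, y) \<in> G" for c x y
  proof -
    obtain z where "z \<in> M" "x = D z" "y = b z"
      using xy by (auto simp: G_def)
    then show ?thesis
      unfolding G_def
      by (intro image_eqI[of _ _ "c *\<^sub>C z"])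
        (simp_all add: bounded_clinear_scaleC[OF D] bounded_clinear_scaleC[OF b] csubspaceD[OF M(1)])
  qed
  have zero: "(0, 0) \<in> G"
    unfolding G_def by (intro image_eqI[of _ _ 0])
      (simp_all add: bounded_clinear_simps[OF D] bounded_clinear_simps[OF b] csubspaceD[OF M(1)])
  have "Domain G = D ` M"
    by (auto simp: G_def)
  moreover have "contraction (closure (Domain G)) N (closure G)"
    by (rule contraction_closure[OF zero add scale _ _ N(2)]) (auto simp: G_def bN le)
  ultimately have con: "contraction (closure (D ` M)) N (closure G)"
    by simp
  then obtain g where g: "op_fun (closure (D ` M)) N g" "closure G = gr (closure (D ` M)) g"
    using ex_op_fun[OF E N contraction_bounded_op] by blast
  have "g (D x) = b x" if "x \<in> M" for x
  proof -
    have "(D x, b x) \<in> closure G"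
      using that closure_subset[of G] by (auto simp: G_def)
    then show ?thesis
      by (simp add: g(2))
  qed
  then show ?thesis
    using g con by auto
qed

text \<open>The second summand is orthogonal to M, so A can only be the compression of t to M. This
  is the first half of the uniqueness required by the \<open>THE\<close> in
  \<open>T_tilde_neg_I\<close>.\<close>

lemma op_plus_contraction_proj:
  assumes M: "csubspace M" "closed M" and T: "gr M t = A \<oplus>\<^sub>o B"
    and A: "contraction M M A" and B: "Range B \<subseteq> ortho M"
  shows "A = gr M (\<lambda>x. proj M (t x))"
proof -
  obtain a where a: "op_fun M M a" "A = gr M a"
    using ex_op_fun[OF M M contraction_bounded_op[OF A]] by blast
  have "proj M (t x) = a x" if "x \<in> M" for x
  proof -
    have "(x, t x) \<in> A \<oplus>\<^sub>o B"
      using that by (simp add: T[symmetric])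
    then obtain c where "t x = a x + c" "(x, c) \<in> B"
      by (auto simp: op_plus_def a(2))
    then show ?thesis
      using op_funD(2)[OF a(1), of x] B by (intro proj_unique[OF M]) auto
  qed
  then show ?thesis
    by (simp add: a(2) gr_eq_iff)
qed

lemma gr_closure_image_eq:
  assumes f: "bounded_clinear f" and g: "bounded_clinear g" and eq: "\<And>x. x \<in> B \<Longrightarrow> f x = g x"
  shows "gr (closure B) f = gr (closure B) g"
proof -
  have "f x = g x" if x: "x \<in> closure B" for x
  proof -
    obtain u where u: "\<forall>n. u n \<in> B" "u \<longlonglongrightarrow> x"
      using x by (auto simp: closure_sequential)
    show ?thesis
      using LIMSEQ_unique[OF bounded_clinear_tendsto[OF f u(2)]] bounded_clinear_tendsto[OF g u(2)]
        u(1) eq by simp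
  qed
  then show ?thesis
    by (simp add: gr_eq_iff)
qed

text \<open>A is the compression of T to M, selfadjoint because T is symmetric. By Pythagoras and
  contractivity, \<open>|T x - A x|\<^sup>2 \<le> |x|\<^sup>2 - |A x|\<^sup>2 = |D
  x|\<^sup>2\<close> on M, which is exactly what lets the second component factor through D by a
  contraction.\<close>

lemma ex_column_form:
  fixes t :: "'a::chilbert_space \<Rightarrow> 'a"
  assumes M: "csubspace M" "closed M" and t: "op_fun M UNIV t" and le: "\<And>x. norm (t x) \<le> norm x"
    and sym: "\<And>x y. x \<in> M \<Longrightarrow> y \<in> M \<Longrightarrow> cinner (t x) y = cinner x (t y)"
  shows "\<exists>a D g. op_fun M M a \<and> (\<forall>x y. cinner (a x) y = cinner x (a y))
    \<and> op_fun M M D \<and> (\<forall>x y. cinner (D x) y = cinner x (D y)) \<and> defect_op M M (gr M a) = gr M D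
    \<and> (\<forall>x\<in>M. D (D x) = x - a (a x)) \<and> (\<forall>x\<in>M. a (D x) = D (a x))
    \<and> op_fun (closure (D ` M)) (ortho M) g
    \<and> contraction (closure (D ` M)) (ortho M) (gr (closure (D ` M)) g)
    \<and> (\<forall>x\<in>M. a x + g (D x) = t x)
    \<and> (THE (A, G). column_form (gr M t) A G) = (gr M a, gr (closure (D ` M)) g)"
proof -
  note N = csubspace_ortho[of M] closed_ortho[of M] and Ft = op_funD[OF t]
  define a where "a x = proj M (t x)" for x
  have a: "op_fun M M a"
    unfolding op_fun_def a_def
    using bounded_clinear_compose[OF bounded_clinear_proj[OF M] Ft(1)] proj_mem[OF M] Ft(3) by simp
  note Fa = op_funD[OF a]
  have a_le: "norm (a x) \<le> norm x" for x
    unfolding a_def by (rule order.trans[OF norm_proj_le[OF M] le])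
  have a_sym: "cinner (a x) y = cinner x (a y)" for x y
  proof -
    have "cinner (a x) y = cinner (t (proj M x)) (proj M y)"
      by (simp add: a_def cinner_proj[OF M] Ft)
    also have "\<dots> = cinner (proj M x) (t (proj M y))"
      by (rule sym[OF proj_mem[OF M] proj_mem[OF M]])
    finally show ?thesis
      by (simp add: a_def cinner_proj[OF M] Ft)
  qed
  have adj_a: "adj a = a"
    by (rule ext, rule adj_unique[OF Fa(1)]) (rule a_sym)
  obtain D where D_def: "defect_op M M (gr M a) = gr M D" and D: "op_fun M M D"
    and DD: "\<And>x. x \<in> M \<Longrightarrow> D (D x) = x - a (a x)"
    and D_sym: "\<And>x y. cinner (D x) y = cinner x (D y)"
    and D_comm: "\<And>f x. bounded_linear f \<Longrightarrow> (\<And>x. f x \<in> M) \<Longrightarrow> (\<And>x. f (a (a x)) = a (a (f x))) \<Longrightarrow>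
      x \<in> M \<Longrightarrow> f (D x) = D (f x)"
    using ex_defect_op[OF M M a a_le] unfolding adj_a by blast
  note FD = op_funD[OF D]
  have aD: "a (D x) = D (a x)" if "x \<in> M" for x
    by (rule D_comm[OF bounded_clinear_bounded_linear[OF Fa(1)] Fa(2) refl that])
  define b where "b x = t x - a x" for x
  have b: "bounded_clinear b"
    unfolding b_def by (rule bounded_clinear_diff[OF Ft(1) Fa(1)])
  have b_mem: "b x \<in> ortho M" for x
    unfolding b_def a_def by (rule diff_proj_mem[OF M])
  have b_le: "norm (b x) \<le> norm (D x)" if x: "x \<in> M" for x
  proof (rule power2_le_imp_le)
    have "(norm (b x))\<^sup>2 = (norm (t x))\<^sup>2 - (norm (a x))\<^sup>2"
      using power2_norm_proj[OF M, of "t x"] by (simp add: a_def b_def)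
    also have "\<dots> \<le> (norm x)\<^sup>2 - (norm (a x))\<^sup>2"
      using power_mono[OF le norm_ge_zero, of x 2] by simp
    also have "\<dots> = Re (cinner x (D (D x)))"
      by (simp add: DD x cinner.diff_right power2_norm_eq_cinner a_sym)
    also have "\<dots> = (norm (D x))\<^sup>2"
      by (simp add: power2_norm_eq_cinner D_sym)
    finally show "(norm (b x))\<^sup>2 \<le> (norm (D x))\<^sup>2" .
  qed simp
  define E where "E = closure (D ` M)"
  have E: "csubspace E" "closed E"
    unfolding E_def by (auto intro: csubspace_closure csubspace_image FD M)
  obtain g where g: "op_fun E (ortho M) g" and g_con: "contraction E (ortho M) (gr E g)"
    and gD: "\<And>x. x \<in> M \<Longrightarrow> g (D x) = b x"
    using ex_factor_through_defect[OF M N FD(1) b b_mem b_le] unfolding E_def by blast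
  have space: "defect_space M M (gr M a) = E"
    unfolding defect_space_def D_def E_def by (rule arg_cong[where f = closure]) (auto simp: gr_def)
  have D_E: "D x \<in> E" if "x \<in> M" for x
    unfolding E_def by (rule subsetD[OF closure_subset imageI[OF that]])
  have agD: "a x + g (D x) = t x" if "x \<in> M" for x
    using that by (simp add: gD b_def)
  have "(THE (A, G). column_form (gr M t) A G) = (gr M a, gr E g)"
  proof (rule the_equality)
    have "selfadjoint_op M (gr M a)"
      by (simp add: selfadjoint_op_def op_adjoint_gr[OF M M a] adj_a)
    then show "case (gr M a, gr E g) of (A, G) \<Rightarrow> column_form (gr M t) A G"
      using contraction_gr[OF M M a a_le] g_con D_E agD
      by (simp add: column_form_def space D_def relcomp_gr op_plus_gr gr_eq_iff)
  next
    fix p assume "case p of (A, G) \<Rightarrow> column_form (gr M t) A G"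
    then obtain A G where p: "p = (A, G)" and "column_form (gr M t) A G"
      by (cases p) auto
    then have A: "contraction M M A" and G: "contraction (defect_space M M A) (ortho M) G"
      and T: "gr M t = A \<oplus>\<^sub>o (defect_op M M A O G)"
      by (simp_all add: column_form_def Let_def)
    have "Range (defect_op M M A O G) \<subseteq> ortho M"
      using G by (auto simp: contraction_def)
    then have A_eq: "A = gr M a"
      using op_plus_contraction_proj[OF M T A] by (simp add: a_def[abs_def])
    obtain g' where g': "op_fun E (ortho M) g'" "G = gr E g'"
      using ex_op_fun[OF E N contraction_bounded_op] G by (auto simp: A_eq space)
    have "gr M t = gr M (\<lambda>x. a x + g' (D x))"
      using T D_E by (simp add: A_eq D_def g'(2) relcomp_gr op_plus_gr)
    then have "g' (D x) = g (D x)" if "x \<in> M" for x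
      using agD that unfolding gr_eq_iff by (metis add_left_cancel)
    then have "gr E g' = gr E g"
      unfolding E_def by (intro gr_closure_image_eq op_funD(1)[OF g'(1)] op_funD(1)[OF g]) auto
    then show "p = (gr M a, gr E g)"
      by (simp add: p A_eq g'(2))
  qed
  then show ?thesis
    using a a_sym D D_sym D_def DD aD g g_con agD unfolding E_def by blast
qed

lemma block_op_gr:
  fixes M :: "'a::chilbert_space set"
  assumes M: "csubspace M" "closed M"
    and k: "\<And>u v. u \<in> M \<Longrightarrow> v \<in> ortho M \<Longrightarrow> k (u + v) = (f11 u + f12 v) + (f21 u + f22 v)"
  shows "block_op (gr M f11) (gr (ortho M) f12) (gr M f21) (gr (ortho M) f22) = gr UNIV k"
proof -
  have "(x, k x) \<in> block_op (gr M f11) (gr (ortho M) f12) (gr M f21) (gr (ortho M) f22)" for x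
  proof -
    have "k x = (f11 (proj M x) + f12 (x - proj M x)) + (f21 (proj M x) + f22 (x - proj M x))"
      using k[OF proj_mem[OF M, of x] diff_proj_mem[OF M, of x]] by simp
    moreover have "x = proj M x + (x - proj M x)"
      by simp
    ultimately show ?thesis
      unfolding block_op_def using proj_mem[OF M, of x] diff_proj_mem[OF M, of x] by fastforce
  qed
  then show ?thesis
    by (auto simp: block_op_def k)
qed

text \<open>
  The last conclusion expresses that the subspace M is dense with respect to the form of \<open>I + k\<close>.
\<close>

lemma T_tilde_neg_I_gr:
  fixes t :: "'a::chilbert_space \<Rightarrow> 'a"
  assumes M: "csubspace M" "closed M" and t: "op_fun M UNIV t" and le: "\<And>x. norm (t x) \<le> norm x"
    and sym: "\<And>x y. x \<in> M \<Longrightarrow> y \<in> M \<Longrightarrow> cinner (t x) y = cinner x (t y)"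
  shows "\<exists>k. T_tilde_neg_I (gr M t) = gr UNIV k \<and> bounded_clinear k
    \<and> (\<forall>x y. cinner (k x) y = cinner x (k y)) \<and> (\<forall>x\<in>M. k x = t x)
    \<and> (\<forall>x. \<exists>h. (\<forall>n. h n \<in> M) \<and> (\<lambda>n. h n + k (h n)) \<longlonglongrightarrow> x + k x \<and>
        ((\<lambda>(m, n). cinner (h n - h m) ((h n - h m) + k (h n - h m))) \<longlongrightarrow> 0)
          (sequentially \<times>\<^sub>F sequentially))"
proof -
  define N where "N = ortho M"
  have N: "csubspace N" "closed N"
    by (simp_all add: N_def csubspace_ortho closed_ortho)
  obtain a D g where a: "op_fun M M a" and a_sym: "\<And>x y. cinner (a x) y = cinner x (a y)"
    and D: "op_fun M M D" and D_sym: "\<And>x y. cinner (D x) y = cinner x (D y)"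
    and D_def: "defect_op M M (gr M a) = gr M D"
    and DD: "\<And>x. x \<in> M \<Longrightarrow> D (D x) = x - a (a x)" and aD: "\<And>x. x \<in> M \<Longrightarrow> a (D x) = D (a x)"
    and g0: "op_fun (closure (D ` M)) N g"
    and g0_con: "contraction (closure (D ` M)) N (gr (closure (D ` M)) g)"
    and agD: "\<And>x. x \<in> M \<Longrightarrow> a x + g (D x) = t x"
    and col0: "(THE (A, G). column_form (gr M t) A G) = (gr M a, gr (closure (D ` M)) g)"
    using ex_column_form[OF M t le sym] unfolding N_def by blast
  note Fa = op_funD[OF a] and FD = op_funD[OF D]
  define E where "E = closure (D ` M)"
  have E: "csubspace E" "closed E"
    unfolding E_def by (auto intro: csubspace_closure csubspace_image FD M)
  note g = g0[folded E_def] and g_con = g0_con[folded E_def] and col = col0[folded E_def]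
  note Fg = op_funD[OF g]
  have space: "defect_space M M (gr M a) = E"
    unfolding defect_space_def D_def E_def by (rule arg_cong[where f = closure]) (auto simp: gr_def)
  define g' where "g' = adj g"
  have g': "op_fun N E g'"
    unfolding g'_def by (rule op_fun_adj[OF E N g])
  note Fg' = op_funD[OF g']
  have g_sym: "cinner (g x) y = cinner x (g' y)" and g'_sym: "cinner (g' x) y = cinner x (g y)" for x y
    by (simp_all add: g'_def cinner_adj[OF Fg(1)] cinner_adj'[OF Fg(1)])
  have g'_le: "norm (g' x) \<le> norm x" for x
    using norm_adj_le[OF Fg(1), of 1 x] norm_op_fun_le[OF E N g g_con] by (simp add: g'_def)
  have adj_g': "adj g' = g"
    unfolding g'_def by (rule adj_adj[OF Fg(1)])
  have E_M: "E \<subseteq> M"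
    unfolding E_def using FD(2) by (intro closure_minimal M) auto
  obtain Q where Q_def: "defect_op N E (gr N g') = gr N Q" and Q: "op_fun N N Q"
    and QQ: "\<And>x. x \<in> N \<Longrightarrow> Q (Q x) = x - g (g' x)"
    using ex_defect_op[OF N E g' g'_le] unfolding adj_g' by blast
  note lin = bounded_clinear_simps[OF Fa(1)] bounded_clinear_simps[OF FD(1)]
    bounded_clinear_simps[OF Fg(1)] bounded_clinear_simps[OF Fg'(1)]
    bounded_clinear_simps[OF bounded_clinear_proj[OF M]]
  note linC = bounded_clinear_scaleC[OF Fa(1)] bounded_clinear_scaleC[OF FD(1)]
    bounded_clinear_scaleC[OF Fg(1)] bounded_clinear_scaleC[OF Fg'(1)]
    bounded_clinear_scaleC[OF bounded_clinear_proj[OF M]]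
  \<comment> \<open>The four block entries added up without splitting x: \<open>a\<close> and
    \<open>D\<close> vanish on N, \<open>g'\<close> vanishes on M, and the identity of N is
    \<open>x - proj M x\<close>. The square of the last defect operator has been multiplied
    out.\<close>
  define k where "k x = a x + g (D x) + D (g' x) + g (g' x) - g (a (g' x)) - (x - proj M x)" for x
  have "bounded_linear k"
    unfolding k_def
    by (intro bounded_linear_add bounded_linear_sub bounded_linear_ident bounded_clinear_bounded_linear
        bounded_clinear_proj[OF M] bounded_clinear_compose[OF Fg(1)] bounded_clinear_compose[OF FD(1)]
        bounded_clinear_compose[OF Fa(1)] Fa(1) FD(1) Fg(1) Fg'(1))
  then have k: "bounded_clinear k"
    unfolding bounded_clinear_def
    by (simp add: k_def linC scaleC_add_right scaleC_diff_right)
  have k_sym: "cinner (k x) y = cinner x (k y)" for x y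
    by (simp add: k_def cinner_add_left cinner_add_right cinner.diff_left cinner.diff_right
        a_sym D_sym g_sym g'_sym cinner_proj[OF M])
  have k_sum: "k (u + v) = (a u + D (g' v)) + (g (D u) + (- g (a (g' v)) - (v - g (g' v))))"
    if u: "u \<in> M" and v: "v \<in> N" for u v
  proof -
    have "u \<in> ortho N"
      using u by (simp add: N_def ortho_ortho[OF M])
    then have "g' u = 0"
      by (rule op_fun_ortho[OF N g'])
    moreover have "a v = 0" "D v = 0" "proj M v = 0"
      using v op_fun_ortho[OF M] a D proj_ortho[OF M] unfolding N_def by blast+
    ultimately show ?thesis
      by (simp add: k_def lin proj_on[OF M u] algebra_simps)
  qed
  have k_on: "k x = t x" if "x \<in> M" for x
    using k_sum[OF that csubspaceD(1)[OF N(1)]] agD[OF that] by (simp add: lin)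
  have "T_tilde_neg_I (gr M t) = gr UNIV k"
  proof -
    have Dom: "Domain (gr M t) = M"
      by simp
    have gadj: "op_adjoint E N (gr E g) = gr N g'"
      unfolding g'_def by (rule op_adjoint_gr[OF E N g])
    have r1: "gr N g' O gr M D = gr N (\<lambda>v. D (g' v))"
      using Fg'(2) E_M by (intro relcomp_gr) blast
    have r2: "gr M D O gr E g = gr M (\<lambda>u. g (D u))"
      unfolding E_def using closure_subset[of "D ` M"] by (intro relcomp_gr) blast
    have r3: "gr N g' O gr M a O gr E g = gr N (\<lambda>v. g (a (g' v)))"
    proof -
      have aE: "a x \<in> E" if "x \<in> E" for x
      proof -
        obtain u where u: "\<forall>n. u n \<in> D ` M" "u \<longlonglongrightarrow> x"
          using \<open>x \<in> E\<close> unfolding E_def by (auto simp: closure_sequential)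
        have "a (u n) \<in> E" for n
        proof -
          obtain m where "m \<in> M" "u n = D m"
            using u(1) by blast
          then have "a (u n) \<in> D ` M"
            using aD Fa(2) by simp
          then show ?thesis
            unfolding E_def by (rule subsetD[OF closure_subset])
        qed
        then show ?thesis
          by (rule closed_sequentially[OF E(2) _ bounded_clinear_tendsto[OF Fa(1) u(2)]])
      qed
      have "gr N g' O gr M a = gr N (\<lambda>v. a (g' v))"
        using Fg'(2) E_M by (intro relcomp_gr) blast
      then have "(gr N g' O gr M a) O gr E g = gr N (\<lambda>v. g (a (g' v)))"
        using Fg'(2) aE by (simp add: relcomp_gr)
      then show ?thesis
        by (simp only: O_assoc)
    qed
    have r4: "gr N Q O gr N Q = gr N (\<lambda>v. v - g (g' v))"
      using op_funD(2)[OF Q] QQ by (simp add: relcomp_gr gr_eq_iff)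
    show ?thesis
      unfolding T_tilde_neg_I_def Let_def Dom col N_def[symmetric] prod.case D_def space gadj Q_def
        r1 r2 r3 r4 op_uminus_gr op_minus_gr
      unfolding N_def by (rule block_op_gr[OF M], rule k_sum) (simp_all only: N_def)
  qed
  moreover have "\<exists>h. (\<forall>n. h n \<in> M) \<and> (\<lambda>n. h n + k (h n)) \<longlonglongrightarrow> x + k x \<and>
      ((\<lambda>(m, n). cinner (h n - h m) ((h n - h m) + k (h n - h m))) \<longlongrightarrow> 0)
        (sequentially \<times>\<^sub>F sequentially)" for x
  proof -
    define u v where "u = proj M x" and "v = x - proj M x"
    have u: "u \<in> M" and v: "v \<in> N" and x: "x = u + v"
      unfolding u_def v_def N_def using proj_mem[OF M] diff_proj_mem[OF M] by auto
    define w where "w = g' v"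
    have "w \<in> E"
      unfolding w_def by (rule Fg'(2))
    then have "\<exists>z. (\<forall>n. z n \<in> D ` M) \<and> z \<longlonglongrightarrow> w"
      unfolding E_def closure_sequential .
    then obtain z where "\<forall>n. \<exists>\<kappa>\<in>M. z n = D \<kappa>" and z: "z \<longlonglongrightarrow> w"
      by blast
    then obtain \<kappa> where \<kappa>: "\<And>n. \<kappa> n \<in> M" "\<And>n. z n = D (\<kappa> n)"
      by metis
    define h where "h n = u + (\<kappa> n - a (\<kappa> n))" for n
    have h: "h n \<in> M" for n
      unfolding h_def by (intro csubspaceD(2,4)[OF M(1)] u \<kappa>(1) Fa(2))
    \<comment> \<open>By \<open>(I + A) (I - A) = D\<^sup>2\<close> and
      \<open>D (I - A) = (I - A) D\<close> on M, the right side contains \<open>\<kappa> n\<close>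
      only through \<open>z n\<close>, whose convergence is known.\<close>
    have "h n + k (h n) = u + a u + g (D u) + D (z n) + g (z n - a (z n))" for n
      using DD[OF \<kappa>(1)[of n]] aD[OF \<kappa>(1)[of n]]
      by (simp add: k_on[OF h] agD[OF h, symmetric]) (simp add: h_def lin \<kappa>(2))
    moreover have "(\<lambda>n. u + a u + g (D u) + D (z n) + g (z n - a (z n)))
        \<longlonglongrightarrow> u + a u + g (D u) + D w + g (w - a w)"
      by (intro tendsto_add tendsto_const bounded_clinear_tendsto[OF FD(1)]
          bounded_clinear_tendsto[OF Fg(1)] tendsto_diff bounded_clinear_tendsto[OF Fa(1)] z)
    moreover have "x + k x = u + a u + g (D u) + D w + g (w - a w)"
      unfolding x k_sum[OF u v] by (simp add: w_def lin)
    ultimately have lim: "(\<lambda>n. h n + k (h n)) \<longlonglongrightarrow> x + k x"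
      by simp
    \<comment> \<open>The component of \<open>k d\<close> orthogonal to M drops out, leaving
      \<open><(I - A) \<delta>, D\<^sup>2 \<delta>>\<close>; moving one D to the left gives a
      bounded form in \<open>y = D \<delta>\<close>, which tends to 0 with y.\<close>
    have form: "cinner d (d + k d) = cinner (y - a y) y"
      if d_def: "d = h n - h m" and y_def: "y = z n - z m" for m n d y
    proof -
      define \<delta> where "\<delta> = \<kappa> n - \<kappa> m"
      have \<delta>: "\<delta> \<in> M"
        unfolding \<delta>_def by (rule csubspaceD(4)[OF M(1) \<kappa>(1) \<kappa>(1)])
      have d: "d = \<delta> - a \<delta>" and y: "y = D \<delta>"
        by (simp_all add: d_def y_def \<delta>_def h_def lin \<kappa>(2))
      have dM: "d \<in> M"
        unfolding d_def by (rule csubspaceD(4)[OF M(1) h h])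
      have "cinner d (g (D d)) = 0"
        using orthoD[OF dM] Fg(2) unfolding N_def by blast
      then have "cinner d (d + k d) = cinner d (d + a d)"
        by (simp add: k_on[OF dM] agD[OF dM, symmetric] cinner_add_right)
      also have "d + a d = D (D \<delta>)"
        by (simp add: d lin DD[OF \<delta>])
      also have "cinner d (D (D \<delta>)) = cinner (D d) (D \<delta>)"
        by (simp add: D_sym)
      also have "D d = y - a y"
        by (simp add: d y lin aD[OF \<delta>])
      finally show ?thesis
        by (simp add: y)
    qed
    have "((\<lambda>p. z (snd p) - z (fst p)) \<longlongrightarrow> w - w) (sequentially \<times>\<^sub>F sequentially)"
      by (intro tendsto_diff filterlim_compose[OF z] filterlim_fst filterlim_snd)
    then have y_lim: "((\<lambda>p. z (snd p) - z (fst p)) \<longlongrightarrow> 0) (sequentially \<times>\<^sub>F sequentially)"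
      by simp
    have "((\<lambda>p. cinner ((z (snd p) - z (fst p)) - a (z (snd p) - z (fst p))) (z (snd p) - z (fst p)))
        \<longlongrightarrow> cinner (0 - a 0) 0) (sequentially \<times>\<^sub>F sequentially)"
      by (intro cinner.tendsto tendsto_diff bounded_clinear_tendsto[OF Fa(1)] y_lim)
    then have "((\<lambda>(m, n). cinner (h n - h m) ((h n - h m) + k (h n - h m))) \<longlongrightarrow> 0)
        (sequentially \<times>\<^sub>F sequentially)"
      by (simp add: form[OF refl refl] case_prod_unfold lin)
    then show ?thesis
      using h lim by blast
  qed
  ultimately show ?thesis
    using k k_sym k_on by blast
qed

section \<open>The Cayley transform\<close>

text \<open>The two factors of the product pick an image of the same x independently;
  single-valuedness identifies the two picks.\<close>

lemma cayley_iff: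
  assumes "single_valued X"
  shows "(h, k) \<in> cayley X \<longleftrightarrow> (\<exists>x y. (x, y) \<in> X \<and> h = x + y \<and> k = x - y)"
proof -
  have "(x, h) \<in> Id \<oplus>\<^sub>o X \<longleftrightarrow> (\<exists>y. (x, y) \<in> X \<and> h = x + y)"
    and "(x, k) \<in> Id \<ominus>\<^sub>o X \<longleftrightarrow> (\<exists>y. (x, y) \<in> X \<and> k = x - y)" for x
    by (auto simp: op_plus_def op_minus_def)
  then have "(h, k) \<in> cayley X \<longleftrightarrow>
      (\<exists>x. (\<exists>y. (x, y) \<in> X \<and> h = x + y) \<and> (\<exists>y. (x, y) \<in> X \<and> k = x - y))"
    by (simp only: cayley_def relcomp_unfold converse_iff mem_Collect_eq case_prod_conv)
  also have "\<dots> \<longleftrightarrow> (\<exists>x y. (x, y) \<in> X \<and> h = x + y \<and> k = x - y)"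
    using single_valuedD[OF assms] by metis
  finally show ?thesis .
qed

context
  fixes S :: "'a::chilbert_space rel"
  assumes S: "positive_op UNIV S"
begin

private lemmas lin = linear_opD[OF positive_opD(1)[OF S]]

lemma cayley_pos_iff: "(h, k) \<in> cayley S \<longleftrightarrow> (\<exists>x y. (x, y) \<in> S \<and> h = x + y \<and> k = x - y)"
  by (rule cayley_iff[OF lin(1)])

text \<open>Positivity makes the cross term in the expanded squares nonnegative. The first two
  bounds serve the closedness of the domain of T, the third its contractivity.\<close>

lemma norm_add_ge:
  assumes "(x, y) \<in> S"
  shows "norm x \<le> norm (x + y)" "norm y \<le> norm (x + y)" "norm (x - y) \<le> norm (x + y)"
proof -
  have "Re (cinner x y) \<ge> 0"
    using positive_opD(6)[OF S assms] arg_cong[OF cinner_commute[of x y], of Re] by simp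
  note nonneg = this
  show "norm x \<le> norm (x + y)" "norm y \<le> norm (x + y)" "norm (x - y) \<le> norm (x + y)"
    by (rule power2_le_imp_le; simp add: power2_norm_add power2_norm_diff nonneg)+
qed

lemma contraction_cayley: "contraction (Domain (cayley S)) UNIV (cayley S)"
proof -
  have norm_le: "norm k \<le> norm h" if "(h, k) \<in> cayley S" for h k
    using that norm_add_ge(3) by (auto simp: cayley_pos_iff)
  have add: "(h + h', k + k') \<in> cayley S" if hk: "(h, k) \<in> cayley S" "(h', k') \<in> cayley S" for h k h' k'
  proof -
    obtain x y x' y' where "(x, y) \<in> S" "h = x + y" "k = x - y" "(x', y') \<in> S" "h' = x' + y'" "k' = x' - y'"
      using hk unfolding cayley_pos_iff by blast
    then show ?thesis
      unfolding cayley_pos_iff by (intro exI[of _ "x + x'"] exI[of _ "y + y'"]) (simp add: lin(3))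
  qed
  have scale: "(c *\<^sub>C h, c *\<^sub>C k) \<in> cayley S" if hk: "(h, k) \<in> cayley S" for c h k
  proof -
    obtain x y where "(x, y) \<in> S" "h = x + y" "k = x - y"
      using hk unfolding cayley_pos_iff by blast
    then show ?thesis
      unfolding cayley_pos_iff
      by (intro exI[of _ "c *\<^sub>C x"] exI[of _ "c *\<^sub>C y"]) (simp add: lin(4) scaleC_add_right scaleC_diff_right)
  qed
  have "single_valued (cayley S)"
  proof (rule single_valuedI)
    fix h k k' assume "(h, k) \<in> cayley S" "(h, k') \<in> cayley S"
    then have "(h + (-1) *\<^sub>C h, k + (-1) *\<^sub>C k') \<in> cayley S"
      by (intro add scale)
    from norm_le[OF this] show "k = k'"
      by (simp add: scaleC_minus_one)
  qed
  moreover have "(0, 0) \<in> cayley S"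
    unfolding cayley_pos_iff using lin(2) by force
  ultimately show ?thesis
    using add scale norm_le by (simp add: contraction_def linear_op_def split_beta)
qed

text \<open>If the sums \<open>x + S x\<close> converge, \<open>norm_add_ge\<close> makes x and
  \<open>S x\<close> separately Cauchy, and closedness of S places the pair of limits in S.\<close>

lemma closed_Domain_cayley:
  assumes cl: "closed S"
  shows "closed (Domain (cayley S))"
proof (unfold closed_sequential_limits, intro allI impI)
  fix h l assume hl: "(\<forall>n. h n \<in> Domain (cayley S)) \<and> h \<longlonglongrightarrow> l"
  then have "\<forall>n. \<exists>p. (fst p, snd p) \<in> S \<and> h n = fst p + snd p"
    unfolding Domain_iff cayley_pos_iff by (metis fst_conv snd_conv)
  then obtain p where p: "\<And>n. (fst (p n), snd (p n)) \<in> S" "\<And>n. h n = fst (p n) + snd (p n)"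
    by metis
  have le: "norm (fst (p m) - fst (p n)) \<le> norm (h m - h n)"
    "norm (snd (p m) - snd (p n)) \<le> norm (h m - h n)" for m n
    using norm_add_ge(1,2)[OF lin(5)[OF p(1)[of m] p(1)[of n]]] by (simp_all add: p(2) add_diff_add)
  have "Cauchy h"
    using hl LIMSEQ_imp_Cauchy by blast
  then have "Cauchy (\<lambda>n. fst (p n))" "Cauchy (\<lambda>n. snd (p n))"
    unfolding Cauchy_def dist_norm using le by (meson le_less_trans)+
  then obtain x y where xy: "(\<lambda>n. fst (p n)) \<longlonglongrightarrow> x" "(\<lambda>n. snd (p n)) \<longlonglongrightarrow> y"
    using Cauchy_convergent convergent_def by metis
  have "(x, y) \<in> S"
    by (rule closed_sequentially[OF cl p(1) tendsto_Pair[OF xy]])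
  moreover have "l = x + y"
    by (rule LIMSEQ_unique[of h]) (use hl tendsto_add[OF xy] in \<open>simp_all add: p(2)[symmetric]\<close>)
  ultimately show "l \<in> Domain (cayley S)"
    unfolding Domain_iff cayley_pos_iff by blast
qed

lemma symmetric_cayley:
  assumes "(h, k) \<in> cayley S" "(h', k') \<in> cayley S"
  shows "cinner k h' = cinner h k'"
proof -
  obtain x y x' y' where *: "(x, y) \<in> S" "h = x + y" "k = x - y" "(x', y') \<in> S" "h' = x' + y'" "k' = x' - y'"
    using assms unfolding cayley_pos_iff by blast
  then have "cinner y x' = cinner x y'"
    by (intro positive_opD(4)[OF S])
  then show ?thesis
    by (simp add: * cinner_add_left cinner_add_right cinner.diff_left cinner.diff_right)
qed

section \<open>The Friedrichs extension\<close>

lemma op_app_eq: "(x, y) \<in> S \<Longrightarrow> S \<diamondop> x = y"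
  unfolding op_app_def using single_valuedD[OF lin(1)] by blast

lemma friedrichs_extI:
  assumes "(\<xi>, \<eta>) \<in> op_adjoint UNIV UNIV S" "\<And>n. (x n, y n) \<in> S" "x \<longlonglongrightarrow> \<xi>"
    "((\<lambda>(m, n). cinner (x n - x m) (y n - y m)) \<longlongrightarrow> 0) (sequentially \<times>\<^sub>F sequentially)"
  shows "(\<xi>, \<eta>) \<in> friedrichs_ext S"
proof -
  have "S \<diamondop> (x n - x m) = y n - y m" for m n
    by (rule op_app_eq[OF lin(5)[OF assms(2) assms(2)]])
  then show ?thesis
    unfolding friedrichs_ext_def using assms by (auto intro!: exI[of _ x])
qed

lemma friedrichs_extE:
  assumes "(\<xi>, \<eta>) \<in> friedrichs_ext S"
  obtains x y where "\<And>n. (x n, y n) \<in> S" "x \<longlonglongrightarrow> \<xi>"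
    "\<And>e. e > 0 \<Longrightarrow> \<exists>n0. \<forall>m\<ge>n0. \<forall>n\<ge>n0. Re (cinner (y n - y m) (x n - x m)) < e"
    "\<And>f w. (f, w) \<in> S \<Longrightarrow> cinner w \<xi> = cinner f \<eta>"
proof -
  obtain x where x: "\<forall>n. x n \<in> Domain S" "x \<longlonglongrightarrow> \<xi>"
    and lim: "((\<lambda>(m, n). cinner (x n - x m) (S \<diamondop> (x n - x m))) \<longlongrightarrow> 0) (sequentially \<times>\<^sub>F sequentially)"
    using assms unfolding friedrichs_ext_def by blast
  have "\<forall>n. \<exists>y. (x n, y) \<in> S"
    using x(1) by blast
  then obtain y where y: "\<And>n. (x n, y n) \<in> S"
    by metis
  have eq: "cinner (x n - x m) (S \<diamondop> (x n - x m)) = cinner (y n - y m) (x n - x m)" for m n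
  proof -
    have d: "(x n - x m, y n - y m) \<in> S"
      by (rule lin(5)[OF y y])
    show ?thesis
      unfolding op_app_eq[OF d] by (rule positive_opD(4)[OF S d d, symmetric])
  qed
  have "\<exists>n0. \<forall>m\<ge>n0. \<forall>n\<ge>n0. Re (cinner (y n - y m) (x n - x m)) < e" if e: "e > 0" for e
  proof -
    have "\<forall>\<^sub>F p in sequentially \<times>\<^sub>F sequentially.
        norm (cinner (y (snd p) - y (fst p)) (x (snd p) - x (fst p))) < e"
      using tendstoD[OF lim e] by (simp add: eq split_beta)
    then obtain n0 where n0: "\<forall>m\<ge>n0. \<forall>n\<ge>n0. norm (cinner (y m - y n) (x m - x n)) < e"
      by (auto simp: eventually_prod_sequentially)
    then show ?thesis
      by (intro exI[of _ n0]) (meson complex_Re_le_cmod le_less_trans)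
  qed
  moreover have "cinner w \<xi> = cinner f \<eta>" if "(f, w) \<in> S" for f w
    using assms that unfolding friedrichs_ext_def op_adjoint_def by blast
  ultimately show thesis
    using that y x(2) by blast
qed

text \<open>With q the form of S, \<open>a = x n0\<close> and \<open>b = x n - x n0\<close>, the
  parallelogram identity gives \<open>q (a + b) \<le> 2 * q a + 2 * q b\<close>, since
  \<open>q (a - b)\<close> is nonnegative. As \<open>q b < 1\<close>, this is the bound
  \<open>B\<close>.\<close>

lemma form_bounded:
  assumes xy: "\<And>n. (x n, y n) \<in> S"
    and cau: "\<And>e. e > 0 \<Longrightarrow> \<exists>n0. \<forall>m\<ge>n0. \<forall>n\<ge>n0. Re (cinner (y n - y m) (x n - x m)) < e"
  shows "\<exists>B\<ge>0. \<exists>n0 :: nat. \<forall>n\<ge>n0. Re (cinner (y n) (x n)) \<le> B"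
proof -
  obtain n0 where n0: "\<And>m n. m \<ge> n0 \<Longrightarrow> n \<ge> n0 \<Longrightarrow> Re (cinner (y n - y m) (x n - x m)) < 1"
    using cau[of 1] by auto
  define B where "B = 2 * Re (cinner (y n0) (x n0)) + 2"
  have "Re (cinner (y n) (x n)) \<le> B" if n: "n \<ge> n0" for n
  proof -
    have "(x n0 - (x n - x n0), y n0 - (y n - y n0)) \<in> S"
      by (intro lin(5) xy)
    then have "Re (cinner (y n0 - (y n - y n0)) (x n0 - (x n - x n0))) \<ge> 0"
      by (rule positive_opD(6)[OF S])
    moreover have "cinner (y n) (x n) + cinner (y n0 - (y n - y n0)) (x n0 - (x n - x n0))
        = 2 * cinner (y n0) (x n0) + 2 * cinner (y n - y n0) (x n - x n0)"
      by (simp add: cinner.diff_left cinner.diff_right cinner_add_left cinner_add_right algebra_simps)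
    from arg_cong[OF this, of Re]
    have "Re (cinner (y n) (x n)) + Re (cinner (y n0 - (y n - y n0)) (x n0 - (x n - x n0)))
        = 2 * Re (cinner (y n0) (x n0)) + 2 * Re (cinner (y n - y n0) (x n - x n0))"
      by simp
    ultimately show ?thesis
      using n0[OF order.refl n] by (simp add: B_def)
  qed
  moreover have "B \<ge> 0"
    using positive_opD(6)[OF S xy, of n0] by (simp add: B_def)
  ultimately show ?thesis
    by blast
qed

text \<open>
  Both sides are iterated limits of \<open>\<langle>x\<^sub>m, S x'\<^sub>n\<rangle>\<close>; the Cauchy-Schwarz inequality for the form of S
  makes the convergence in \<open>m\<close> uniform in \<open>n\<close>.
\<close>

lemma symmetric_friedrichs_ext:
  assumes "(\<xi>, \<eta>) \<in> friedrichs_ext S" "(\<xi>', \<eta>') \<in> friedrichs_ext S"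
  shows "cinner \<eta> \<xi>' = cinner \<xi> \<eta>'"
proof -
  obtain x y where x: "\<And>n. (x n, y n) \<in> S" "x \<longlonglongrightarrow> \<xi>"
    and cau: "\<And>e. e > 0 \<Longrightarrow> \<exists>n0. \<forall>m\<ge>n0. \<forall>n\<ge>n0. Re (cinner (y n - y m) (x n - x m)) < e"
    and adj: "\<And>f w. (f, w) \<in> S \<Longrightarrow> cinner w \<xi> = cinner f \<eta>"
    by (rule friedrichs_extE[OF assms(1)]) (rule that)
  obtain x' y' where x': "\<And>n. (x' n, y' n) \<in> S" "x' \<longlonglongrightarrow> \<xi>'"
    and cau': "\<And>e. e > 0 \<Longrightarrow> \<exists>n0. \<forall>m\<ge>n0. \<forall>n\<ge>n0. Re (cinner (y' n - y' m) (x' n - x' m)) < e"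
    and adj': "\<And>f w. (f, w) \<in> S \<Longrightarrow> cinner w \<xi>' = cinner f \<eta>'"
    by (rule friedrichs_extE[OF assms(2)]) (rule that)
  obtain B n1 where B: "B \<ge> 0" "\<And>n. n \<ge> n1 \<Longrightarrow> Re (cinner (y' n) (x' n)) \<le> B"
    using form_bounded[OF x'(1) cau'] by blast
  have adj_left: "cinner \<xi> (y' n) = cinner \<eta> (x' n)" for n
    using arg_cong[OF adj[OF x'(1)[of n]], of cnj] by (simp flip: cinner_commute)
  have S_sym: "cinner (x m) (y' n) = cinner (y m) (x' n)" for m n
    by (rule positive_opD(4)[OF S x(1) x'(1), symmetric])
  have le: "(cmod (cinner \<xi> \<eta>' - cinner \<eta> \<xi>'))\<^sup>2 \<le> e * B" if e: "e > 0" for e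
  proof -
    obtain n0 where n0: "\<And>m k. m \<ge> n0 \<Longrightarrow> k \<ge> n0 \<Longrightarrow> Re (cinner (y k - y m) (x k - x m)) < e"
      using cau[OF e] by blast
    \<comment> \<open>The bound is uniform in k, m and n beyond thresholds independent of one
      another, so the limits can be taken in the order k, n, m: the first uses that \<eta> is the
      adjoint image of \<xi>, the second the same for \<eta>' and \<xi>', the third only norm
      convergence.\<close>
    have 1: "(cmod (cinner (x k) (y' n) - cinner (x m) (y' n)))\<^sup>2 \<le> e * B"
      if k: "k \<ge> n0" and m: "m \<ge> n0" and n: "n \<ge> n1" for k m n
    proof -
      have d: "(x k - x m, y k - y m) \<in> S"
        by (rule lin(5)[OF x(1) x(1)])
      have "cinner (x k) (y' n) - cinner (x m) (y' n) = cinner (y k - y m) (x' n)"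
        by (simp add: S_sym cinner.diff_left)
      also have "(cmod \<dots>)\<^sup>2 \<le> Re (cinner (y k - y m) (x k - x m)) * Re (cinner (y' n) (x' n))"
        by (rule positive_op_Cauchy_Schwarz[OF S d x'(1)])
      also have "\<dots> \<le> e * B"
        using n0[OF m k] B(2)[OF n] e positive_opD(6)[OF S x'(1)] by (intro mult_mono) auto
      finally show ?thesis .
    qed
    have 2: "(cmod (cinner \<eta> (x' n) - cinner (y m) (x' n)))\<^sup>2 \<le> e * B" if m: "m \<ge> n0" and n: "n \<ge> n1" for m n
    proof (rule Lim_bounded[where M = n0])
      show "(\<lambda>k. (cmod (cinner (x k) (y' n) - cinner (x m) (y' n)))\<^sup>2)
          \<longlonglongrightarrow> (cmod (cinner \<eta> (x' n) - cinner (y m) (x' n)))\<^sup>2"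
        unfolding adj_left[symmetric] S_sym[symmetric]
        by (intro tendsto_power tendsto_norm tendsto_diff tendsto_const cinner.tendsto x(2))
    qed (use 1 m n in blast)
    have 3: "(cmod (cinner \<eta> \<xi>' - cinner (x m) \<eta>'))\<^sup>2 \<le> e * B" if m: "m \<ge> n0" for m
    proof (rule Lim_bounded[where M = n1])
      show "(\<lambda>n. (cmod (cinner \<eta> (x' n) - cinner (y m) (x' n)))\<^sup>2)
          \<longlonglongrightarrow> (cmod (cinner \<eta> \<xi>' - cinner (x m) \<eta>'))\<^sup>2"
        unfolding adj'[OF x(1), symmetric]
        by (intro tendsto_power tendsto_norm tendsto_diff tendsto_const cinner.tendsto x'(2))
    qed (use 2 m in blast)
    have "(cmod (cinner \<eta> \<xi>' - cinner \<xi> \<eta>'))\<^sup>2 \<le> e * B"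
    proof (rule Lim_bounded[where M = n0])
      show "(\<lambda>m. (cmod (cinner \<eta> \<xi>' - cinner (x m) \<eta>'))\<^sup>2)
          \<longlonglongrightarrow> (cmod (cinner \<eta> \<xi>' - cinner \<xi> \<eta>'))\<^sup>2"
        by (intro tendsto_power tendsto_norm tendsto_diff tendsto_const cinner.tendsto x(2))
    qed (use 3 in blast)
    then show ?thesis
      by (simp add: norm_minus_commute)
  qed
  have "(cmod (cinner \<xi> \<eta>' - cinner \<eta> \<xi>'))\<^sup>2 \<le> 0 + e" if e: "e > 0" for e
  proof -
    \<comment> \<open>The denominator is \<open>B + 1\<close> because B may be 0.\<close>
    have "(cmod (cinner \<xi> \<eta>' - cinner \<eta> \<xi>'))\<^sup>2 \<le> e / (B + 1) * B"
      using e B(1) by (intro le) simp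
    also have "\<dots> \<le> e"
      using e B(1) by (simp add: field_simps)
    finally show ?thesis
      by simp
  qed
  then have "(cmod (cinner \<xi> \<eta>' - cinner \<eta> \<xi>'))\<^sup>2 \<le> 0"
    by (rule field_le_epsilon)
  then show ?thesis
    by simp
qed

end

section \<open>Equality of the two selfadjoint extensions\<close>

theorem proposition4p3:
  fixes S :: "'a::chilbert_space rel"
  assumes "positive_op UNIV S"
    and "closed S"
  shows "S_tilde_F S = friedrichs_ext S"
proof -
  note S = assms(1)
  note lin = linear_opD[OF positive_opD(1)[OF S]]
  note cayley_S = cayley_pos_iff[OF S]
  define M where "M = Domain (cayley S)"
  have con: "contraction M UNIV (cayley S)"
    unfolding M_def by (rule contraction_cayley[OF S])
  have M: "csubspace M" "closed M"
    using con closed_Domain_cayley[OF S assms(2)] by (auto simp: M_def contraction_def csubspace_Domain)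
  have U: "csubspace UNIV" "closed (UNIV :: 'a set)"
    by (simp_all add: csubspace_UNIV)
  obtain t where t: "op_fun M UNIV t" and T: "cayley S = gr M t"
    using ex_op_fun[OF M U contraction_bounded_op[OF con]] by blast
  have T_iff: "h \<in> M \<and> k = t h \<longleftrightarrow> (\<exists>x y. (x, y) \<in> S \<and> h = x + y \<and> k = x - y)" for h k
    using cayley_S[of h k] by (simp add: T)
  have t_sym: "cinner (t x) y = cinner x (t y)" if "x \<in> M" "y \<in> M" for x y
    using symmetric_cayley[OF S, of x "t x" y "t y"] that by (simp add: T)
  obtain k where k_gr: "T_tilde_neg_I (gr M t) = gr UNIV k" and k: "bounded_clinear k"
    and k_sym: "\<And>x y. cinner (k x) y = cinner x (k y)" and k_on: "\<And>x. x \<in> M \<Longrightarrow> k x = t x"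
    and approx: "\<And>x. \<exists>h. (\<forall>n. h n \<in> M) \<and> (\<lambda>n. h n + k (h n)) \<longlonglongrightarrow> x + k x \<and>
        ((\<lambda>(m, n). cinner (h n - h m) ((h n - h m) + k (h n - h m))) \<longlongrightarrow> 0)
          (sequentially \<times>\<^sub>F sequentially)"
    using T_tilde_neg_I_gr[OF M t norm_op_fun_le[OF M U t con[unfolded T]] t_sym] by blast
  note k_lin = bounded_clinear_simps[OF k]
  have k_half: "k ((1/2) *\<^sub>R x) = (1/2) *\<^sub>R k x" for x
    by (simp add: scaleR_scaleC bounded_clinear_scaleC[OF k])
  have "single_valued (gr UNIV k)"
    by (auto simp: single_valued_def)
  then have S_tilde: "(\<xi>, \<eta>) \<in> S_tilde_F S \<longleftrightarrow> (\<exists>x. \<xi> = x + k x \<and> \<eta> = x - k x)" for \<xi> \<eta>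
    unfolding S_tilde_F_def T k_gr by (subst cayley_iff) auto
  \<comment> \<open>For \<open>h = x + S x\<close> the transform gives \<open>k h = x - S x\<close>,
    so the pair is \<open>(2 x, 2 S x)\<close>.\<close>
  have S_mem: "(h + k h, h - k h) \<in> S" if h: "h \<in> M" for h
  proof -
    obtain x y where "(x, y) \<in> S" "h = x + y" "k h = x - y"
      using T_iff[of h "k h"] h k_on[OF h] by blast
    moreover from this have "(x + x, y + y) \<in> S"
      by (intro lin(3))
    ultimately show ?thesis
      by simp
  qed
  have sub: "(x + k x, x - k x) \<in> friedrichs_ext S" for x
  proof -
    obtain h where h: "\<And>n. h n \<in> M" and lim: "(\<lambda>n. h n + k (h n)) \<longlonglongrightarrow> x + k x"
      and form: "((\<lambda>(m, n). cinner (h n - h m) ((h n - h m) + k (h n - h m))) \<longlongrightarrow> 0)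
          (sequentially \<times>\<^sub>F sequentially)"
      using approx[of x] by blast
    \<comment> \<open>Symmetry of k, tested at \<open>f + w\<close> where k takes the value
      \<open>f - w\<close>, rearranges into the defining condition of the adjoint of S.\<close>
    have "cinner w (x + k x) = cinner f (x - k x)" if "(f, w) \<in> S" for f w
    proof -
      have "f + w \<in> M" "f - w = t (f + w)"
        using T_iff[of "f + w" "f - w"] that by blast+
      then have "cinner (f - w) x = cinner (f + w) (k x)"
        using k_sym[of "f + w" x] k_on by simp
      then show ?thesis
        by (simp add: cinner_add_left cinner_add_right cinner.diff_left cinner.diff_right algebra_simps)
    qed
    then have adj: "(x + k x, x - k x) \<in> op_adjoint UNIV UNIV S"
      unfolding op_adjoint_def by blast
    define d where "d p = (h (snd p) + k (h (snd p))) - (h (fst p) + k (h (fst p)))" for p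
    have "((\<lambda>p. d p) \<longlongrightarrow> (x + k x) - (x + k x)) (sequentially \<times>\<^sub>F sequentially)"
      unfolding d_def
      by (intro tendsto_diff filterlim_compose[OF lim] filterlim_fst filterlim_snd)
    then have d_lim: "(d \<longlongrightarrow> 0) (sequentially \<times>\<^sub>F sequentially)"
      by simp
    \<comment> \<open>For e in M the left side is the form of S at d. It thus tends to 0 as soon as
      the form of \<open>I + k\<close> at e and the norm of d do.\<close>
    have "cinner d (e - k e) = 2 * cinner e d - cinner d d" if "d = e + k e" for d e
    proof -
      have "cinner d e = cinner e d"
        by (simp add: that cinner_add_left cinner_add_right k_sym)
      moreover have "e - k e = 2 *\<^sub>R e - d"
        by (simp add: that scaleR_2)
      ultimately show ?thesis
        by (simp add: cinner.diff_right cinner_scaleR_right)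
    qed
    note split = this
    have "((\<lambda>p. cinner (h (snd p) - h (fst p)) ((h (snd p) - h (fst p)) + k (h (snd p) - h (fst p))))
        \<longlongrightarrow> 0) (sequentially \<times>\<^sub>F sequentially)"
      using form by (simp only: case_prod_unfold)
    note form' = this
    have "((\<lambda>p. 2 * cinner (h (snd p) - h (fst p)) ((h (snd p) - h (fst p)) + k (h (snd p) - h (fst p)))
        - cinner (d p) (d p)) \<longlongrightarrow> 2 * 0 - cinner 0 (0 :: 'a)) (sequentially \<times>\<^sub>F sequentially)"
      by (rule tendsto_diff[OF tendsto_mult[OF tendsto_const form'] cinner.tendsto[OF d_lim d_lim]])
    moreover have "2 * cinner (h (snd p) - h (fst p)) ((h (snd p) - h (fst p)) + k (h (snd p) - h (fst p)))
        - cinner (d p) (d p) = cinner ((h (snd p) + k (h (snd p))) - (h (fst p) + k (h (fst p))))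
          ((h (snd p) - k (h (snd p))) - (h (fst p) - k (h (fst p))))" for p
    proof -
      have d_eq: "d p = (h (snd p) - h (fst p)) + k (h (snd p) - h (fst p))"
        by (simp add: d_def k_lin)
      have diff_eq: "(h (snd p) - h (fst p)) - k (h (snd p) - h (fst p))
          = (h (snd p) - k (h (snd p))) - (h (fst p) - k (h (fst p)))"
        by (simp add: k_lin)
      show ?thesis
        unfolding d_eq[symmetric] split[OF d_eq, symmetric] diff_eq by (simp add: d_def)
    qed
    ultimately have "((\<lambda>(m, n). cinner ((h n + k (h n)) - (h m + k (h m)))
        ((h n - k (h n)) - (h m - k (h m)))) \<longlongrightarrow> 0) (sequentially \<times>\<^sub>F sequentially)"
      by (simp only: case_prod_unfold) simp
    then show ?thesis
      by (rule friedrichs_extI[OF S adj S_mem[OF h] lim])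
  qed
  have "(\<xi>, \<eta>) \<in> S_tilde_F S" if F: "(\<xi>, \<eta>) \<in> friedrichs_ext S" for \<xi> \<eta>
  proof -
    \<comment> \<open>Maximality of the selfadjoint operator in concrete form: by
      \<open>sub\<close>, the symmetric operator F can be tested against
      \<open>(x + k x, x - k x)\<close> for every x of the space.\<close>
    have "cinner x (\<eta> + k \<eta>) = cinner x (\<xi> - k \<xi>)" for x
    proof -
      have "cinner (x - k x) \<xi> = cinner (x + k x) \<eta>"
        by (rule symmetric_friedrichs_ext[OF S sub F])
      then show ?thesis
        by (simp add: cinner_add_left cinner_add_right cinner.diff_left cinner.diff_right k_sym)
    qed
    then have eq: "\<eta> + k \<eta> = \<xi> - k \<xi>"
      by (rule cinner_eqI)
    \<comment> \<open>Adding the desired equations \<open>\<xi> = x + k x\<close> and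
      \<open>\<eta> = x - k x\<close> forces this x; their difference is then supplied by
      \<open>eq\<close>.\<close>
    define x where "x = (1/2) *\<^sub>R (\<xi> + \<eta>)"
    have kx: "k x = (1/2) *\<^sub>R (\<xi> - \<eta>)"
      using eq by (simp add: x_def k_half k_lin) (simp add: algebra_simps)
    have "\<xi> = x + k x" "\<eta> = x - k x"
      unfolding kx unfolding x_def scaleR_add_right[symmetric] scaleR_diff_right[symmetric]
      by (simp_all flip: scaleR_2)
    then show ?thesis
      unfolding S_tilde by blast
  qed
  then show ?thesis
    using sub S_tilde by auto
qed

end
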